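(* Let $W_4$ be a planar $4$-web on a domain $D$ of the plane. Then there exists a unique projective structure on $D$ such that the leaves of all four foliations of $W_4$ are geodesics of this projective structure.
   Context: All objects are smooth. A planar $d$-web on a domain $D\subset\mathbb{R}^2$ is given by $d$ one-dimensional foliations of $D$ that are pairwise transversal at every point; locally the foliations are the level sets of web functions $f_1,\dots,f_d$ with $df_i\wedge df_j\neq 0$ at every point for $i\neq j$. Affine connections are torsion-free. Two affine connections $\nabla,\widetilde\nabla$ are projectively equivalent if there is a differential $1$-form $\rho$ with $\nabla_X(Y)-\widetilde\nabla_X(Y)=\rho(X)Y+\rho(Y)X$ for all vector fields $X,Y$. A projective structure is a class of projectively equivalent (torsion-free) affine connections. A geodesic of a projective structure is a curve which, as an unparametrized curve, is a geodesic of one (equivalently, every) connection of the class. *)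

theory Defs
  imports "HOL-Analysis.Analysis" "HOL-Library.Disjoint_Sets" "HOL-Library.FuncSet"
begin

section \<open>Smooth maps\<close>

text \<open>Both notions are meant for open sets \<open>S\<close>.\<close>

primrec times_differentiable_on ::
    "nat \<Rightarrow> 'a set \<Rightarrow> ('a::real_normed_vector \<Rightarrow> 'b::real_normed_vector) \<Rightarrow> bool" where
  "times_differentiable_on 0 S f \<longleftrightarrow> continuous_on S f"
| "times_differentiable_on (Suc n) S f \<longleftrightarrow>
     (\<forall>x\<in>S. f differentiable (at x)) \<and>
     (\<forall>v. times_differentiable_on n S (\<lambda>x. frechet_derivative f (at x) v))"

definition smooth_on :: "'a set \<Rightarrow> ('a::real_normed_vector \<Rightarrow> 'b::real_normed_vector) \<Rightarrow> bool" where
  "smooth_on S f \<longleftrightarrow> (\<forall>n. times_differentiable_on n S f)"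

abbreviation differential :: "('a::real_normed_vector \<Rightarrow> 'b::real_normed_vector) \<Rightarrow> 'a \<Rightarrow> 'a \<Rightarrow> 'b" where
  "differential f p \<equiv> frechet_derivative f (at p)"

definition wedge :: "('a \<Rightarrow> real) \<Rightarrow> ('a \<Rightarrow> real) \<Rightarrow> 'a \<Rightarrow> 'a \<Rightarrow> real" where
  "wedge \<alpha> \<beta> = (\<lambda>v w. \<alpha> v * \<beta> w - \<alpha> w * \<beta> v)"


section \<open>Foliations and webs in the plane\<close>

type_synonym plane = "real ^ 2"

text \<open>
  A foliation is represented by its set of leaves. A web function on \<open>U\<close> is a submersion whose
  level sets are the plaques in \<open>U\<close>, i.e. the connected components of the intersections of the
  leaves with \<open>U\<close>; a single leaf may meet \<open>U\<close> in many plaques.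
\<close>

definition web_function :: "plane set set \<Rightarrow> plane set \<Rightarrow> (plane \<Rightarrow> real) \<Rightarrow> bool" where
  "web_function \<F> U f \<longleftrightarrow>
     open U \<and> smooth_on U f \<and>
     (\<forall>p\<in>U. differential f p \<noteq> (\<lambda>v. 0)) \<and>
     (\<forall>L\<in>\<F>. \<forall>C\<in>components (L \<inter> U). \<exists>c. C = {p \<in> U. f p = c})"

definition foliation :: "plane set \<Rightarrow> plane set set \<Rightarrow> bool" where
  "foliation D \<F> \<longleftrightarrow>
     partition_on D \<F> \<and> (\<forall>L\<in>\<F>. path_connected L) \<and>
     (\<forall>p\<in>D. \<exists>U f. p \<in> U \<and> U \<subseteq> D \<and> web_function \<F> U f)"

text \<open>
  Two web functions of one foliation have proportional differentials at a common point, so it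
  does not matter which ones are used to express transversality.
\<close>

definition transversal_foliations :: "plane set \<Rightarrow> plane set set \<Rightarrow> plane set set \<Rightarrow> bool" where
  "transversal_foliations D \<F> \<G> \<longleftrightarrow>
     (\<forall>p\<in>D. \<exists>U f V g. p \<in> U \<and> U \<subseteq> D \<and> web_function \<F> U f \<and>
        p \<in> V \<and> V \<subseteq> D \<and> web_function \<G> V g \<and>
        wedge (differential f p) (differential g p) \<noteq> (\<lambda>v w. 0))"

definition planar_web :: "nat \<Rightarrow> plane set \<Rightarrow> (nat \<Rightarrow> plane set set) \<Rightarrow> bool" where
  "planar_web d D W \<longleftrightarrow>
     (\<forall>i<d. foliation D (W i)) \<and>
     (\<forall>i<d. \<forall>j<d. i \<noteq> j \<longrightarrow> transversal_foliations D (W i) (W j))"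


section \<open>Affine connections and projective structures\<close>

text \<open>
  Vector fields on \<open>D\<close> are normalised to vanish off \<open>D\<close>, and connections are extensional, so that
  equality of either is equality of the objects on \<open>D\<close>.
\<close>

definition vector_fields :: "plane set \<Rightarrow> (plane \<Rightarrow> plane) set" where
  "vector_fields D = {X. smooth_on D X \<and> (\<forall>p. p \<notin> D \<longrightarrow> X p = 0)}"

type_synonym connection = "(plane \<Rightarrow> plane) \<Rightarrow> (plane \<Rightarrow> plane) \<Rightarrow> plane \<Rightarrow> plane"

definition affine_connection :: "plane set \<Rightarrow> connection \<Rightarrow> bool" where
  "affine_connection D nabla \<longleftrightarrow>
     nabla \<in> vector_fields D \<rightarrow>\<^sub>E vector_fields D \<rightarrow>\<^sub>E vector_fields D \<and>
     (\<forall>X\<in>vector_fields D. \<forall>Y\<in>vector_fields D. \<forall>Z\<in>vector_fields D. \<forall>p\<in>D.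
        nabla (\<lambda>q. X q + Y q) Z p = nabla X Z p + nabla Y Z p \<and>
        nabla Z (\<lambda>q. X q + Y q) p = nabla Z X p + nabla Z Y p) \<and>
     (\<forall>X\<in>vector_fields D. \<forall>Y\<in>vector_fields D. \<forall>h::plane \<Rightarrow> real. smooth_on D h \<longrightarrow> (\<forall>p\<in>D.
        nabla (\<lambda>q. h q *\<^sub>R X q) Y p = h p *\<^sub>R nabla X Y p \<and>
        nabla X (\<lambda>q. h q *\<^sub>R Y q) p = h p *\<^sub>R nabla X Y p + differential h p (X p) *\<^sub>R Y p))"

definition lie_bracket :: "(plane \<Rightarrow> plane) \<Rightarrow> (plane \<Rightarrow> plane) \<Rightarrow> plane \<Rightarrow> plane" where
  "lie_bracket X Y p = differential Y p (X p) - differential X p (Y p)"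

definition torsion_free :: "plane set \<Rightarrow> connection \<Rightarrow> bool" where
  "torsion_free D nabla \<longleftrightarrow>
     (\<forall>X\<in>vector_fields D. \<forall>Y\<in>vector_fields D. \<forall>p\<in>D.
        nabla X Y p - nabla Y X p = lie_bracket X Y p)"

definition torsion_free_connections :: "plane set \<Rightarrow> connection set" where
  "torsion_free_connections D = {nabla. affine_connection D nabla \<and> torsion_free D nabla}"

definition one_form :: "plane set \<Rightarrow> (plane \<Rightarrow> plane \<Rightarrow> real) \<Rightarrow> bool" where
  "one_form D \<rho> \<longleftrightarrow> (\<forall>p\<in>D. linear (\<rho> p)) \<and> (\<forall>v. smooth_on D (\<lambda>p. \<rho> p v))"

definition projectively_equivalent :: "plane set \<Rightarrow> connection \<Rightarrow> connection \<Rightarrow> bool" where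
  "projectively_equivalent D nabla nabla' \<longleftrightarrow>
     (\<exists>\<rho>. one_form D \<rho> \<and>
       (\<forall>X\<in>vector_fields D. \<forall>Y\<in>vector_fields D. \<forall>p\<in>D.
          nabla X Y p - nabla' X Y p = \<rho> p (X p) *\<^sub>R Y p + \<rho> p (Y p) *\<^sub>R X p))"

definition projective_structures :: "plane set \<Rightarrow> connection set set" where
  "projective_structures D =
     torsion_free_connections D //
       {(nabla, nabla'). nabla \<in> torsion_free_connections D \<and> nabla' \<in> torsion_free_connections D \<and>
                 projectively_equivalent D nabla nabla'}"


section \<open>Geodesics\<close>

definition open_interval :: "real set \<Rightarrow> bool" where
  "open_interval I \<longleftrightarrow> open I \<and> is_interval I \<and> I \<noteq> {}"

definition velocity :: "(real \<Rightarrow> plane) \<Rightarrow> real \<Rightarrow> plane" where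
  "velocity \<gamma> t = vector_derivative \<gamma> (at t)"

definition regular_curve :: "real set \<Rightarrow> (real \<Rightarrow> plane) \<Rightarrow> bool" where
  "regular_curve I \<gamma> \<longleftrightarrow> open_interval I \<and> smooth_on I \<gamma> \<and> (\<forall>t\<in>I. velocity \<gamma> t \<noteq> 0)"

definition coordinate_field :: "plane set \<Rightarrow> 2 \<Rightarrow> plane \<Rightarrow> plane" where
  "coordinate_field D i p = (if p \<in> D then axis i 1 else 0)"

text \<open>
  The covariant derivative of the velocity along \<open>\<gamma>\<close>, in the standard coordinates of the plane:
  the vector \<open>nabla (coordinate_field D i) (coordinate_field D j) p\<close> has the Christoffel symbols
  \<open>\<Gamma>\<^sup>k\<^sub>i\<^sub>j(p)\<close> as its components.
\<close>

definition covariant_acceleration ::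
    "plane set \<Rightarrow> connection \<Rightarrow> (real \<Rightarrow> plane) \<Rightarrow> real \<Rightarrow> plane" where
  "covariant_acceleration D nabla \<gamma> t =
     vector_derivative (velocity \<gamma>) (at t) +
     (\<Sum>i\<in>UNIV. \<Sum>j\<in>UNIV. (velocity \<gamma> t $ i * velocity \<gamma> t $ j) *\<^sub>R
        nabla (coordinate_field D i) (coordinate_field D j) (\<gamma> t))"

definition affine_geodesic :: "plane set \<Rightarrow> connection \<Rightarrow> real set \<Rightarrow> (real \<Rightarrow> plane) \<Rightarrow> bool" where
  "affine_geodesic D nabla I \<gamma> \<longleftrightarrow>
     regular_curve I \<gamma> \<and> \<gamma> ` I \<subseteq> D \<and> (\<forall>t\<in>I. covariant_acceleration D nabla \<gamma> t = 0)"

text \<open>A map with nowhere vanishing derivative on an interval is automatically injective there.\<close>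

definition reparametrization :: "real set \<Rightarrow> real set \<Rightarrow> (real \<Rightarrow> real) \<Rightarrow> bool" where
  "reparametrization J I \<phi> \<longleftrightarrow>
     open_interval J \<and> smooth_on J \<phi> \<and> (\<forall>s\<in>J. deriv \<phi> s \<noteq> 0) \<and> \<phi> ` J = I"

definition unparametrized_geodesic ::
    "plane set \<Rightarrow> connection \<Rightarrow> real set \<Rightarrow> (real \<Rightarrow> plane) \<Rightarrow> bool" where
  "unparametrized_geodesic D nabla I \<gamma> \<longleftrightarrow>
     regular_curve I \<gamma> \<and> (\<exists>J \<phi>. reparametrization J I \<phi> \<and> affine_geodesic D nabla J (\<gamma> \<circ> \<phi>))"

definition projective_geodesic ::
    "plane set \<Rightarrow> connection set \<Rightarrow> real set \<Rightarrow> (real \<Rightarrow> plane) \<Rightarrow> bool" where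
  "projective_geodesic D P I \<gamma> \<longleftrightarrow> (\<exists>nabla\<in>P. unparametrized_geodesic D nabla I \<gamma>)"

text \<open>
  A leaf of a foliation is an immersed curve, given here as a point set; it is a geodesic if each
  of its regular parametrizations, including those of mere pieces of it, is one. Every point of a
  leaf lies on such a piece, so the condition is not vacuous.
\<close>

definition leaf_is_geodesic :: "plane set \<Rightarrow> connection set \<Rightarrow> plane set \<Rightarrow> bool" where
  "leaf_is_geodesic D P L \<longleftrightarrow>
     (\<forall>I \<gamma>. regular_curve I \<gamma> \<and> \<gamma> ` I \<subseteq> L \<longrightarrow> projective_geodesic D P I \<gamma>)"

end

(*
  In the standard coordinates a torsion-free connection is its Christoffel symbols G(u,v), and its
  projective class is determined by the binary cubic Q(v) = v x G(v,v), where x is the determinant.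
  A regular curve c is an unparametrized geodesic iff c' x c'' + Q(c') = 0. Along the leaves of a
  foliation with web function f, differentiating f(c(t)) = const twice turns this into the condition
  that Q takes a prescribed value, computed from the Hessian of f, at the tangent direction of the
  leaf. At each point the four pairwise transversal foliations thus prescribe Q in four pairwise
  independent directions, and a binary cubic is uniquely determined by such values. Lagrange
  interpolation shows that the resulting field of cubics is smooth.
*)
theory Submission
  imports Defs
begin

section \<open>Smooth maps\<close>

text \<open>Leaves are bare point sets, and the geodesic condition speaks only of regular curves
  inside them. Uniqueness is out of reach unless such a curve exists through every point of every
  leaf, so one has to be built: the inverse function theorem straightens a web function, and a
  coordinate line is pulled back. The same curves show that the tangent direction does not depend on
  the web function, so that transversality, postulated for one pair of web functions, holds for any
  pair. The value prescribed at V is the Hessian of f at V, where V is the gradient of f turned by a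
  right angle: then df(w) = V x w, and for c' = s V both c' x c'' and Q(c') carry the factor s^3, so
  the parametrization drops out. Reciprocals, leaf curves and changes of parameter are smooth for
  one common reason: each solves y' = V(y) with smooth V, and order n for y gives order n for y',
  hence n + 1 for y. Projective classes are compared only through their cubics; the one-form between
  two connections with equal cubics is a third of a trace, hence smooth.\<close>

lemma frechet_derivative_eqI: "(f has_derivative f') (at x) \<Longrightarrow> frechet_derivative f (at x) = f'"
  by (rule frechet_derivative_at[symmetric])

lemma has_derivative_differential:
  "f differentiable (at x) \<Longrightarrow> (f has_derivative differential f x) (at x)"
  by (simp add: frechet_derivative_works)

text \<open>The derivatives are taken in the full space (\<open>at x\<close>), so they see a whole
  neighbourhood of \<open>x\<close>; openness of \<open>S\<close> provides one on which
  \<open>f\<close> and \<open>g\<close> agree.\<close>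

lemma times_differentiable_on_cong:
  assumes "open S" "\<And>x. x \<in> S \<Longrightarrow> f x = g x" "times_differentiable_on n S f"
  shows "times_differentiable_on n S g"
  using assms(2,3)
proof (induction n arbitrary: f g)
  case 0
  then show ?case by (simp cong: continuous_on_cong)
next
  case (Suc n)
  have der: "(g has_derivative differential f x) (at x)" if "x \<in> S" for x
    using Suc.prems that assms(1)
    by (intro has_derivative_transform_within_open[OF has_derivative_differential]) auto
  have "times_differentiable_on n S (\<lambda>x. differential g x v)" for v
  proof (rule Suc.IH)
    show "times_differentiable_on n S (\<lambda>x. differential f x v)" using Suc.prems by simp
  qed (simp add: frechet_derivative_eqI[OF der])
  then show ?case using der by (auto simp: differentiable_def)
qed

lemma times_differentiable_on_SucD:
  "times_differentiable_on (Suc n) S f \<Longrightarrow> times_differentiable_on n S f"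
proof (induction n arbitrary: f)
  case 0
  then show ?case
    by (simp add: continuous_at_imp_continuous_on differentiable_imp_continuous_within)
next
  case (Suc n)
  from Suc.prems have "\<forall>x\<in>S. f differentiable (at x)"
    and "\<And>v. times_differentiable_on (Suc n) S (\<lambda>x. differential f x v)"
    by simp_all
  with Suc.IH show ?case unfolding times_differentiable_on.simps(2)[of n S f] by blast
qed

lemma times_differentiable_on_subset:
  "times_differentiable_on n S f \<Longrightarrow> T \<subseteq> S \<Longrightarrow> times_differentiable_on n T f"
  by (induction n arbitrary: f) (auto intro: continuous_on_subset)

lemma times_differentiable_on_locally:
  assumes "\<And>x. x \<in> S \<Longrightarrow> \<exists>U. open U \<and> x \<in> U \<and> times_differentiable_on n U f"
  shows "times_differentiable_on n S f"
  using assms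
proof (induction n arbitrary: f)
  case 0
  have "isCont f x" if "x \<in> S" for x
    using 0[OF that] by (auto simp: continuous_on_eq_continuous_at)
  then show ?case by (simp add: continuous_at_imp_continuous_on)
next
  case (Suc n)
  have "times_differentiable_on n S (\<lambda>x. differential f x v)" for v
  proof (rule Suc.IH)
    fix x assume "x \<in> S"
    from Suc.prems[OF this] show "\<exists>U. open U \<and> x \<in> U \<and> times_differentiable_on n U (\<lambda>x. differential f x v)"
      by auto
  qed
  moreover have "f differentiable (at x)" if "x \<in> S" for x
    using Suc.prems[OF that] by auto
  ultimately show ?case by simp
qed

text \<open>The working form of the recursion: any explicitly known derivative may stand in for the
  one selected by \<open>frechet_derivative\<close>.\<close>

lemma times_differentiable_on_SucI:
  assumes "open S" "\<And>x. x \<in> S \<Longrightarrow> (f has_derivative f' x) (at x)"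
    "\<And>v. times_differentiable_on n S (\<lambda>x. f' x v)"
  shows "times_differentiable_on (Suc n) S f"
proof -
  have "times_differentiable_on n S (\<lambda>x. differential f x v)" for v
    by (rule times_differentiable_on_cong[OF assms(1) _ assms(3)[of v]])
       (simp add: frechet_derivative_eqI[OF assms(2)])
  then show ?thesis using assms(2) by (auto simp: differentiable_def)
qed

lemma times_differentiable_on_const: "times_differentiable_on n S (\<lambda>x. c)"
  by (induction n arbitrary: c) auto

lemma times_differentiable_on_linear:
  assumes "bounded_linear L" "open S"
  shows "times_differentiable_on n S L"
proof (cases n)
  case 0
  then show ?thesis using assms by (simp add: linear_continuous_on)
next
  case (Suc m)
  show ?thesis unfolding Suc
    by (rule times_differentiable_on_SucI[OF assms(2) bounded_linear_imp_has_derivative[OF assms(1)]])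
       (rule times_differentiable_on_const)
qed

lemma times_differentiable_on_bounded_linear:
  assumes "bounded_linear L" "open S" "times_differentiable_on n S f"
  shows "times_differentiable_on n S (\<lambda>x. L (f x))"
  using assms(3)
proof (induction n arbitrary: f)
  case 0
  then show ?case using assms by (simp add: bounded_linear.continuous_on)
next
  case (Suc n)
  show ?case
  proof (rule times_differentiable_on_SucI[OF assms(2)])
    fix x assume "x \<in> S"
    then show "((\<lambda>x. L (f x)) has_derivative (\<lambda>v. L (differential f x v))) (at x)"
      using Suc.prems by (intro bounded_linear.has_derivative[OF assms(1)] has_derivative_differential) auto
  qed (use Suc in auto)
qed

lemma times_differentiable_on_add:
  assumes "open S" "times_differentiable_on n S f" "times_differentiable_on n S g"
  shows "times_differentiable_on n S (\<lambda>x. f x + g x)"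
  using assms(2,3)
proof (induction n arbitrary: f g)
  case 0
  then show ?case by (simp add: continuous_on_add)
next
  case (Suc n)
  show ?case
  proof (rule times_differentiable_on_SucI[OF assms(1)])
    fix x assume "x \<in> S"
    then show "((\<lambda>x. f x + g x) has_derivative (\<lambda>v. differential f x v + differential g x v)) (at x)"
      using Suc.prems by (intro has_derivative_add has_derivative_differential) auto
  qed (use Suc in auto)
qed

lemma times_differentiable_on_bilinear:
  assumes "bounded_bilinear B" "open S" "times_differentiable_on n S f" "times_differentiable_on n S g"
  shows "times_differentiable_on n S (\<lambda>x. B (f x) (g x))"
  using assms(3,4)
proof (induction n arbitrary: f g)
  case 0
  then show ?case by (simp add: bounded_bilinear.continuous_on[OF assms(1)])
next
  case (Suc n)
  show ?case
  proof (rule times_differentiable_on_SucI[OF assms(2)])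
    fix x assume "x \<in> S"
    then show "((\<lambda>x. B (f x) (g x)) has_derivative
        (\<lambda>v. B (f x) (differential g x v) + B (differential f x v) (g x))) (at x)"
      using Suc.prems by (intro bounded_bilinear.FDERIV[OF assms(1)] has_derivative_differential) auto
  next
    fix v
    show "times_differentiable_on n S (\<lambda>x. B (f x) (differential g x v) + B (differential f x v) (g x))"
      \<comment> \<open>Each term of the product rule pairs a derivative of order \<open>n\<close>
        with an undifferentiated factor of order \<open>Suc n\<close>; the latter is lowered by one
        so that the induction hypothesis fits both.\<close>
      using Suc.prems[THEN times_differentiable_on_SucD] Suc.prems
      by (intro times_differentiable_on_add[OF assms(2)] Suc.IH) auto
  qed
qed

lemma times_differentiable_on_sum:
  assumes "open S" "\<And>i. i \<in> A \<Longrightarrow> times_differentiable_on n S (f i)"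
  shows "times_differentiable_on n S (\<lambda>x. \<Sum>i\<in>A. f i x)"
  using assms(2)
proof (induction A rule: infinite_finite_induct)
  case (insert a A)
  then show ?case by (simp add: times_differentiable_on_add[OF assms(1)])
qed (simp_all add: times_differentiable_on_const)

lemma times_differentiable_on_compose:
  fixes f :: "'b::euclidean_space \<Rightarrow> 'c::real_normed_vector"
  assumes "open S" "times_differentiable_on n T f" "times_differentiable_on n S g" "g ` S \<subseteq> T"
  shows "times_differentiable_on n S (\<lambda>x. f (g x))"
  using assms(2,3)
proof (induction n arbitrary: f)
  case 0
  then show ?case using assms(4) by (simp add: continuous_on_compose2)
next
  case (Suc n)
  show ?case
  proof (rule times_differentiable_on_SucI[OF assms(1)])
    fix x assume x: "x \<in> S"
    then have g: "(g has_derivative differential g x) (at x)"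
      and f: "(f has_derivative differential f (g x)) (at (g x))"
      using Suc.prems assms(4) by (auto intro!: has_derivative_differential)
    \<comment> \<open>Smoothness only controls \<open>differential f\<close> in fixed directions,
      while the chain rule evaluates it in the moving direction \<open>differential g x v\<close>.
      Expanding that direction in the finite basis turns the derivative into a sum of products to
      which the induction hypothesis applies.\<close>
    have rep: "differential f (g x) w = (\<Sum>b\<in>Basis. (w \<bullet> b) *\<^sub>R differential f (g x) b)" for w
    proof -
      have "linear (differential f (g x))" using f has_derivative_linear by blast
      then have "differential f (g x) (\<Sum>b\<in>Basis. (w \<bullet> b) *\<^sub>R b) =
          (\<Sum>b\<in>Basis. (w \<bullet> b) *\<^sub>R differential f (g x) b)"
        by (simp add: linear_sum linear_scale)
      then show ?thesis by (simp add: euclidean_representation)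
    qed
    show "((\<lambda>x. f (g x)) has_derivative
        (\<lambda>v. \<Sum>b\<in>Basis. (differential g x v \<bullet> b) *\<^sub>R differential f (g x) b)) (at x)"
      using has_derivative_compose[OF g f] unfolding rep[symmetric] .
  next
    fix v
    show "times_differentiable_on n S (\<lambda>x. \<Sum>b\<in>Basis. (differential g x v \<bullet> b) *\<^sub>R differential f (g x) b)"
      using Suc.prems times_differentiable_on_SucD[OF Suc.prems(2)]
      by (intro times_differentiable_on_sum[OF assms(1)]
          times_differentiable_on_bilinear[OF bounded_bilinear_scaleR assms(1)]
          times_differentiable_on_bounded_linear[OF bounded_linear_inner_left assms(1)] Suc.IH) auto
  qed
qed

section \<open>Closure properties of smooth maps\<close>

lemma smooth_on_cong:
  "open S \<Longrightarrow> (\<And>x. x \<in> S \<Longrightarrow> f x = g x) \<Longrightarrow> smooth_on S f \<Longrightarrow> smooth_on S g"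
  unfolding smooth_on_def using times_differentiable_on_cong by metis

lemma smooth_on_subset: "smooth_on S f \<Longrightarrow> T \<subseteq> S \<Longrightarrow> smooth_on T f"
  unfolding smooth_on_def using times_differentiable_on_subset by metis

text \<open>Allows a globally defined map to be proved smooth by comparing it near each point with a
  local formula.\<close>

lemma smooth_on_locally:
  "(\<And>x. x \<in> S \<Longrightarrow> \<exists>U. open U \<and> x \<in> U \<and> smooth_on U f) \<Longrightarrow> smooth_on S f"
  unfolding smooth_on_def using times_differentiable_on_locally by metis

lemma smooth_on_has_derivative:
  "smooth_on S f \<Longrightarrow> x \<in> S \<Longrightarrow> (f has_derivative differential f x) (at x)"
  unfolding smooth_on_def by (metis has_derivative_differential times_differentiable_on.simps(2))

lemma smooth_on_differential: "smooth_on S f \<Longrightarrow> smooth_on S (\<lambda>x. differential f x v)"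
  unfolding smooth_on_def by (metis times_differentiable_on.simps(2))

lemma smooth_on_imp_continuous_on: "smooth_on S f \<Longrightarrow> continuous_on S f"
  unfolding smooth_on_def by (metis times_differentiable_on.simps(1))

lemma smooth_on_const: "smooth_on S (\<lambda>x. c)"
  by (simp add: smooth_on_def times_differentiable_on_const)

lemma smooth_on_linear: "bounded_linear L \<Longrightarrow> open S \<Longrightarrow> smooth_on S L"
  by (simp add: smooth_on_def times_differentiable_on_linear)

lemma smooth_on_bounded_linear:
  "bounded_linear L \<Longrightarrow> open S \<Longrightarrow> smooth_on S f \<Longrightarrow> smooth_on S (\<lambda>x. L (f x))"
  by (simp add: smooth_on_def times_differentiable_on_bounded_linear)

lemma smooth_on_bilinear:
  "bounded_bilinear B \<Longrightarrow> open S \<Longrightarrow> smooth_on S f \<Longrightarrow> smooth_on S g \<Longrightarrow> smooth_on S (\<lambda>x. B (f x) (g x))"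
  by (simp add: smooth_on_def times_differentiable_on_bilinear)

lemma smooth_on_add:
  "open S \<Longrightarrow> smooth_on S f \<Longrightarrow> smooth_on S g \<Longrightarrow> smooth_on S (\<lambda>x. f x + g x)"
  by (simp add: smooth_on_def times_differentiable_on_add)

lemma smooth_on_sum:
  "open S \<Longrightarrow> (\<And>i. i \<in> A \<Longrightarrow> smooth_on S (f i)) \<Longrightarrow> smooth_on S (\<lambda>x. \<Sum>i\<in>A. f i x)"
  by (simp add: smooth_on_def times_differentiable_on_sum)

lemma smooth_on_compose:
  fixes f :: "'b::euclidean_space \<Rightarrow> 'c::real_normed_vector"
  shows "open S \<Longrightarrow> smooth_on T f \<Longrightarrow> smooth_on S g \<Longrightarrow> g ` S \<subseteq> T \<Longrightarrow> smooth_on S (\<lambda>x. f (g x))"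
  unfolding smooth_on_def using times_differentiable_on_compose by metis

lemma smooth_on_minus: "open S \<Longrightarrow> smooth_on S f \<Longrightarrow> smooth_on S (\<lambda>x. - f x)"
  by (rule smooth_on_bounded_linear[OF bounded_linear_minus[OF bounded_linear_ident]])

lemma smooth_on_diff:
  "open S \<Longrightarrow> smooth_on S f \<Longrightarrow> smooth_on S g \<Longrightarrow> smooth_on S (\<lambda>x. f x - g x)"
  using smooth_on_add[of S f "\<lambda>x. - g x"] smooth_on_minus by auto

lemma smooth_on_mult:
  fixes f g :: "'a::real_normed_vector \<Rightarrow> real"
  shows "open S \<Longrightarrow> smooth_on S f \<Longrightarrow> smooth_on S g \<Longrightarrow> smooth_on S (\<lambda>x. f x * g x)"
  by (rule smooth_on_bilinear[OF bounded_bilinear_mult])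

lemma smooth_on_scaleR:
  "open S \<Longrightarrow> smooth_on S f \<Longrightarrow> smooth_on S g \<Longrightarrow> smooth_on S (\<lambda>x. f x *\<^sub>R g x)"
  by (rule smooth_on_bilinear[OF bounded_bilinear_scaleR])

lemma smooth_on_inner:
  "open S \<Longrightarrow> smooth_on S f \<Longrightarrow> smooth_on S g \<Longrightarrow> smooth_on S (\<lambda>x. f x \<bullet> g x)"
  by (rule smooth_on_bilinear[OF bounded_bilinear_inner])

lemma smooth_on_nth:
  "open S \<Longrightarrow> smooth_on S f \<Longrightarrow> smooth_on S (\<lambda>x. f x $ i)"
  by (rule smooth_on_bounded_linear[OF bounded_linear_vec_nth])

lemma smooth_on_prod:
  fixes f :: "'i \<Rightarrow> 'a::real_normed_vector \<Rightarrow> real"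
  shows "open S \<Longrightarrow> (\<And>i. i \<in> A \<Longrightarrow> smooth_on S (f i)) \<Longrightarrow> smooth_on S (\<lambda>x. \<Prod>i\<in>A. f i x)"
  by (induction A rule: infinite_finite_induct) (auto intro: smooth_on_const smooth_on_mult)

text \<open>Bootstrapping: if \<open>y\<close> has order \<open>n\<close>, so has its derivative
  \<open>V (y t)\<close>, and hence \<open>y\<close> has order \<open>Suc n\<close>. Mere
  differentiability of a solution thus suffices.\<close>

lemma smooth_on_autonomous_ode:
  fixes y :: "real \<Rightarrow> 'b::euclidean_space"
  assumes "open I" "smooth_on T V" "y ` I \<subseteq> T"
    and der: "\<And>t. t \<in> I \<Longrightarrow> (y has_vector_derivative V (y t)) (at t)"
  shows "smooth_on I y"
proof -
  have "times_differentiable_on n I y" for n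
  proof (induction n)
    case 0
    have "isCont y t" if "t \<in> I" for t
      using der[OF that] has_vector_derivative_continuous by blast
    then show ?case by (simp add: continuous_at_imp_continuous_on)
  next
    case (Suc n)
    have "times_differentiable_on n I (\<lambda>t. V (y t))"
      using assms(2) by (intro times_differentiable_on_compose[OF assms(1) _ Suc assms(3)]) (simp add: smooth_on_def)
    then have "times_differentiable_on n I (\<lambda>t. v *\<^sub>R V (y t))" for v
      by (rule times_differentiable_on_bounded_linear[OF bounded_linear_scaleR_right assms(1)])
    with assms(1) der show ?case
      unfolding has_vector_derivative_def by (intro times_differentiable_on_SucI) auto
  qed
  then show ?thesis by (simp add: smooth_on_def)
qed

lemma smooth_on_inverse:
  fixes f :: "'a::real_normed_vector \<Rightarrow> real"
  assumes "open S" "smooth_on S f" "\<And>x. x \<in> S \<Longrightarrow> f x \<noteq> 0"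
  shows "smooth_on S (\<lambda>x. inverse (f x))"
proof -
  have "open {x::real. x \<noteq> 0}" by (simp add: open_Collect_neq)
  \<comment> \<open>The reciprocal is smooth because it solves y' = - y^2.\<close>
  moreover have "smooth_on UNIV (\<lambda>y::real. - (y * y))"
    by (intro smooth_on_minus smooth_on_mult smooth_on_linear bounded_linear_ident) auto
  moreover have "(inverse has_vector_derivative - (inverse x * inverse x)) (at x)" if "x \<in> {x::real. x \<noteq> 0}" for x
    using that unfolding has_real_derivative_iff_has_vector_derivative[symmetric]
    by (auto intro!: derivative_eq_intros)
  ultimately have "smooth_on {x::real. x \<noteq> 0} inverse"
    by (rule smooth_on_autonomous_ode[OF _ _ subset_UNIV])
  then show ?thesis by (rule smooth_on_compose[OF assms(1) _ assms(2)]) (use assms(3) in auto)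
qed

lemma smooth_on_divide:
  fixes f g :: "'a::real_normed_vector \<Rightarrow> real"
  assumes "open S" "smooth_on S f" "smooth_on S g" "\<And>x. x \<in> S \<Longrightarrow> g x \<noteq> 0"
  shows "smooth_on S (\<lambda>x. f x / g x)"
  unfolding divide_inverse using assms by (intro smooth_on_mult smooth_on_inverse)

lemma smooth_on_has_vector_derivative:
  fixes f :: "real \<Rightarrow> 'b::real_normed_vector"
  assumes "smooth_on S f" "x \<in> S"
  shows "(f has_vector_derivative vector_derivative f (at x)) (at x)"
  using smooth_on_has_derivative[OF assms] differentiableI vector_derivative_works by blast

lemma smooth_on_vector_derivative:
  fixes f :: "real \<Rightarrow> 'b::real_normed_vector"
  assumes "open S" "smooth_on S f"
  shows "smooth_on S (\<lambda>x. vector_derivative f (at x))"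
proof (rule smooth_on_cong[OF assms(1) _ smooth_on_differential[OF assms(2), of 1]])
  fix x assume "x \<in> S"
  from smooth_on_has_vector_derivative[OF assms(2) this]
  show "differential f x 1 = vector_derivative f (at x)"
    unfolding has_vector_derivative_def by (simp add: frechet_derivative_eqI)
qed

section \<open>Binary cubics and bilinear maps of the plane\<close>

definition cross2 :: "plane \<Rightarrow> plane \<Rightarrow> real" where
  "cross2 u v = u $ 1 * v $ 2 - u $ 2 * v $ 1"

lemma cross2_self [simp]: "cross2 v v = 0"
  by (simp add: cross2_def)

lemma cross2_add_right: "cross2 u (v + w) = cross2 u v + cross2 u w"
  by (simp add: cross2_def algebra_simps)

lemma cross2_scaleR_left [simp]: "cross2 (c *\<^sub>R u) v = c * cross2 u v"
  by (simp add: cross2_def algebra_simps)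

lemma cross2_scaleR_right [simp]: "cross2 u (c *\<^sub>R v) = c * cross2 u v"
  by (simp add: cross2_def algebra_simps)

lemma cross2_diff_right: "cross2 u (v - w) = cross2 u v - cross2 u w"
  by (simp add: cross2_def algebra_simps)

text \<open>The factor is that of the orthogonal projection of \<open>w\<close> onto
  \<open>v\<close>. Having it as an explicit quotient matters later, where it must depend smoothly
  on a parameter.\<close>

lemma cross2_eq_0D:
  assumes "cross2 v w = 0" "v \<noteq> 0"
  shows "w = ((w \<bullet> v) / (v \<bullet> v)) *\<^sub>R v"
proof -
  have 1: "v $ 1 * w $ 2 = v $ 2 * w $ 1" using assms(1) by (simp add: cross2_def)
  have 2: "(v $ 1)\<^sup>2 + (v $ 2)\<^sup>2 \<noteq> 0"
    using assms(2) by (simp add: vec_eq_iff forall_2 sum_power2_eq_zero_iff)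
  have "w $ 1 * ((v $ 1)\<^sup>2 + (v $ 2)\<^sup>2) = (w $ 1 * v $ 1 + w $ 2 * v $ 2) * v $ 1"
    "w $ 2 * ((v $ 1)\<^sup>2 + (v $ 2)\<^sup>2) = (w $ 1 * v $ 1 + w $ 2 * v $ 2) * v $ 2"
    using 1 by algebra+
  with 2 show ?thesis
    by (simp add: vec_eq_iff forall_2 inner_vec_def sum_2 power2_eq_square eq_divide_eq)
qed

lemma smooth_on_cross2:
  "open S \<Longrightarrow> smooth_on S f \<Longrightarrow> smooth_on S g \<Longrightarrow> smooth_on S (\<lambda>x. cross2 (f x) (g x))"
  unfolding cross2_def by (intro smooth_on_diff smooth_on_mult smooth_on_nth)

section \<open>Binary cubics: values, zeros and interpolation\<close>

definition binary_cubic :: "(plane \<Rightarrow> real) \<Rightarrow> bool" where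
  "binary_cubic q \<longleftrightarrow> (\<exists>a b c d. \<forall>v. q v =
     a * v $ 1 ^ 3 + b * (v $ 1)\<^sup>2 * v $ 2 + c * v $ 1 * (v $ 2)\<^sup>2 + d * v $ 2 ^ 3)"

lemma binary_cubicI:
  "(\<And>v. q v = a * v $ 1 ^ 3 + b * (v $ 1)\<^sup>2 * v $ 2 + c * v $ 1 * (v $ 2)\<^sup>2 + d * v $ 2 ^ 3) \<Longrightarrow> binary_cubic q"
  unfolding binary_cubic_def by blast

lemma binary_cubicE:
  assumes "binary_cubic q"
  obtains a b c d where
    "\<And>v. q v = a * v $ 1 ^ 3 + b * (v $ 1)\<^sup>2 * v $ 2 + c * v $ 1 * (v $ 2)\<^sup>2 + d * v $ 2 ^ 3"
  using assms that unfolding binary_cubic_def by blast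

lemma binary_cubic_add:
  assumes "binary_cubic q" "binary_cubic r"
  shows "binary_cubic (\<lambda>v. q v + r v)"
proof -
  obtain a b c d where q: "\<And>v. q v = a * v $ 1 ^ 3 + b * (v $ 1)\<^sup>2 * v $ 2 + c * v $ 1 * (v $ 2)\<^sup>2 + d * v $ 2 ^ 3"
    using assms(1) unfolding binary_cubic_def by blast
  obtain a' b' c' d' where r: "\<And>v. r v = a' * v $ 1 ^ 3 + b' * (v $ 1)\<^sup>2 * v $ 2 + c' * v $ 1 * (v $ 2)\<^sup>2 + d' * v $ 2 ^ 3"
    using assms(2) unfolding binary_cubic_def by blast
  show ?thesis
    by (rule binary_cubicI[where a = "a + a'" and b = "b + b'" and c = "c + c'" and d = "d + d'"])
       (simp add: q r algebra_simps)
qed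

lemma binary_cubic_cmult:
  assumes "binary_cubic q"
  shows "binary_cubic (\<lambda>v. k * q v)"
proof -
  obtain a b c d where q: "\<And>v. q v = a * v $ 1 ^ 3 + b * (v $ 1)\<^sup>2 * v $ 2 + c * v $ 1 * (v $ 2)\<^sup>2 + d * v $ 2 ^ 3"
    using assms(1) unfolding binary_cubic_def by blast
  show ?thesis
    by (rule binary_cubicI[where a = "k * a" and b = "k * b" and c = "k * c" and d = "k * d"])
       (simp add: q algebra_simps)
qed

lemma binary_cubic_sum:
  assumes "\<And>i. i \<in> A \<Longrightarrow> binary_cubic (q i)"
  shows "binary_cubic (\<lambda>v. \<Sum>i\<in>A. q i v)"
  using assms
proof (induction A rule: infinite_finite_induct)
  case (insert i A)
  then show ?case by (simp add: binary_cubic_add)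
qed (auto intro: binary_cubicI[where a = 0 and b = 0 and c = 0 and d = 0])

lemma binary_cubic_prod_cross2:
  assumes "card A = 3"
  shows "binary_cubic (\<lambda>v. \<Prod>j\<in>A. cross2 v (V j) / w j)"
proof -
  obtain i j k where A: "A = {i, j, k}" "i \<noteq> j" "i \<noteq> k" "j \<noteq> k"
    using assms by (auto simp: card_3_iff)
  have "binary_cubic (\<lambda>v. cross2 v B * cross2 v C * cross2 v E)" for B C E
    by (rule binary_cubicI[where a = "B $ 2 * C $ 2 * E $ 2"
          and b = "- (B $ 1 * C $ 2 * E $ 2 + B $ 2 * C $ 1 * E $ 2 + B $ 2 * C $ 2 * E $ 1)"
          and c = "B $ 1 * C $ 1 * E $ 2 + B $ 1 * C $ 2 * E $ 1 + B $ 2 * C $ 1 * E $ 1"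
          and d = "- (B $ 1 * C $ 1 * E $ 1)"])
       (simp add: cross2_def algebra_simps power2_eq_square power3_eq_cube)
  from binary_cubic_cmult[OF this, of "1 / (w i * w j * w k)" "V i" "V j" "V k"]
  show ?thesis using A by (simp add: mult.assoc)
qed

lemma binary_cubic_scaleR:
  assumes "binary_cubic q"
  shows "q (s *\<^sub>R v) = s ^ 3 * q v"
proof -
  obtain a b c d where q: "\<And>v. q v = a * v $ 1 ^ 3 + b * (v $ 1)\<^sup>2 * v $ 2 + c * v $ 1 * (v $ 2)\<^sup>2 + d * v $ 2 ^ 3"
    using assms unfolding binary_cubic_def by blast
  show ?thesis by (simp add: q algebra_simps power2_eq_square power3_eq_cube)
qed

text \<open>With e1, e2 the axes and a, b, c, d the coefficients, q(e1) = a, q(e2) = d, q(e1 + e2) =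
  a + b + c + d and q(e1 - e2) = a - b + c - d; half the sum of the last two is a + c, half the
  difference is b + d. Values at fixed vectors thus give the coefficients, so a field of cubics that
  is smooth at each fixed vector has smooth coefficients.\<close>

lemma binary_cubic_values:
  assumes "binary_cubic q"
  shows "q v = q (axis 1 1) * v $ 1 ^ 3
    + ((q (axis 1 1 + axis 2 1) - q (axis 1 1 - axis 2 1)) / 2 - q (axis 2 1)) * (v $ 1)\<^sup>2 * v $ 2
    + ((q (axis 1 1 + axis 2 1) + q (axis 1 1 - axis 2 1)) / 2 - q (axis 1 1)) * v $ 1 * (v $ 2)\<^sup>2
    + q (axis 2 1) * v $ 2 ^ 3"
  using assms by (rule binary_cubicE) (simp add: axis_def field_simps)

lemma linear_form2_eq_0:
  fixes a b :: real
  assumes "a * x + b * y = 0" "a * x' + b * y' = 0" "x * y' - x' * y \<noteq> 0"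
  shows "a = 0" "b = 0"
proof -
  have "a * (x * y' - x' * y) = 0" "b * (x * y' - x' * y) = 0"
    using assms(1,2) by algebra+
  with assms(3) show "a = 0" "b = 0" by auto
qed

text \<open>In coordinates \<sigma>, \<tau> for the basis \<open>V 0\<close>, \<open>V 1\<close>,
  the two zeros on the basis remove the pure cubes, leaving \<sigma> \<tau> times a linear form.
  \<open>V 2\<close> and \<open>V 3\<close> lie off both axes, so the linear form vanishes at two
  independent vectors and is zero.\<close>

lemma binary_cubic_zero:
  fixes V :: "nat \<Rightarrow> plane"
  assumes q: "binary_cubic q" and zero: "\<And>i. i < 4 \<Longrightarrow> q (V i) = 0"
    and indep: "\<And>i j. i < 4 \<Longrightarrow> j < 4 \<Longrightarrow> i \<noteq> j \<Longrightarrow> cross2 (V i) (V j) \<noteq> 0"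
  shows "q v = 0"
proof -
  define x y where "x = V 0" and "y = V 1"
  define D where "D = cross2 x y"
  \<comment> \<open>The coordinates of \<open>w\<close> in the basis \<open>x\<close>,
    \<open>y\<close>, by Cramer's rule.\<close>
  define s t where "s w = cross2 w y / D" and "t w = cross2 x w / D" for w
  have D: "D \<noteq> 0" using indep[of 0 1] by (simp add: D_def x_def y_def)
  obtain a b c d where abcd: "\<And>v. q v = a * v $ 1 ^ 3 + b * (v $ 1)\<^sup>2 * v $ 2 + c * v $ 1 * (v $ 2)\<^sup>2 + d * v $ 2 ^ 3"
    using q unfolding binary_cubic_def by blast
  have rep: "w = s w *\<^sub>R x + t w *\<^sub>R y" for w
  proof -
    have "D * w $ 1 = cross2 w y * x $ 1 + cross2 x w * y $ 1"
      "D * w $ 2 = cross2 w y * x $ 2 + cross2 x w * y $ 2"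
      by (auto simp: D_def cross2_def algebra_simps)
    with D show ?thesis by (simp add: s_def t_def vec_eq_iff forall_2 field_simps)
  qed
  \<comment> \<open>\<beta> and \<gamma> are the coefficients of \<sigma>^2 \<tau> and \<sigma>
    \<tau>^2 in q(\<sigma> x + \<tau> y).\<close>
  define \<beta> where "\<beta> = 3 * a * (x $ 1)\<^sup>2 * y $ 1 + b * ((x $ 1)\<^sup>2 * y $ 2 + 2 * x $ 1 * x $ 2 * y $ 1)
     + c * (2 * x $ 1 * x $ 2 * y $ 2 + (x $ 2)\<^sup>2 * y $ 1) + 3 * d * (x $ 2)\<^sup>2 * y $ 2"
  define \<gamma> where "\<gamma> = 3 * a * (y $ 1)\<^sup>2 * x $ 1 + b * ((y $ 1)\<^sup>2 * x $ 2 + 2 * y $ 1 * y $ 2 * x $ 1)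
     + c * (2 * y $ 1 * y $ 2 * x $ 2 + (y $ 2)\<^sup>2 * x $ 1) + 3 * d * (y $ 2)\<^sup>2 * x $ 2"
  have "q (\<sigma> *\<^sub>R x + \<tau> *\<^sub>R y) = \<sigma> ^ 3 * q x + \<tau> ^ 3 * q y + \<sigma> * \<tau> * (\<beta> * \<sigma> + \<gamma> * \<tau>)" for \<sigma> \<tau>
    unfolding abcd \<beta>_def \<gamma>_def by (simp add: algebra_simps power2_eq_square power3_eq_cube)
  then have fact: "q (\<sigma> *\<^sub>R x + \<tau> *\<^sub>R y) = \<sigma> * \<tau> * (\<beta> * \<sigma> + \<gamma> * \<tau>)" for \<sigma> \<tau>
    using zero[of 0] zero[of 1] by (simp add: x_def y_def)
  have st: "s (V i) \<noteq> 0" "t (V i) \<noteq> 0" "\<beta> * s (V i) + \<gamma> * t (V i) = 0" if "i = 2 \<or> i = 3" for i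
  proof -
    show *: "s (V i) \<noteq> 0" "t (V i) \<noteq> 0"
      using that D indep[of i 1] indep[of 0 i] by (auto simp: s_def t_def x_def y_def)
    have "q (V i) = 0" using that zero[of i] by auto
    with * show "\<beta> * s (V i) + \<gamma> * t (V i) = 0"
      using fact[of "s (V i)" "t (V i)"] rep[of "V i"] by simp
  qed
  \<comment> \<open>The determinant of two vectors is that of their coordinates times
    \<open>D\<close>, so independence passes to the coordinate pairs.\<close>
  have "cross2 (V 2) (V 3) = (s (V 2) * t (V 3) - s (V 3) * t (V 2)) * D"
    by (subst rep[of "V 2"], subst rep[of "V 3"]) (simp add: D_def cross2_def algebra_simps)
  then have "s (V 2) * t (V 3) - s (V 3) * t (V 2) \<noteq> 0"
    using indep[of 2 3] by auto
  then have "\<beta> = 0" "\<gamma> = 0" using linear_form2_eq_0 st(3) by blast+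
  then show ?thesis using rep[of v] fact[of "s v" "t v"] by simp
qed

lemma binary_cubic_eqI:
  fixes V :: "nat \<Rightarrow> plane"
  assumes "binary_cubic q" "binary_cubic r" "\<And>i. i < 4 \<Longrightarrow> q (V i) = r (V i)"
    and "\<And>i j. i < 4 \<Longrightarrow> j < 4 \<Longrightarrow> i \<noteq> j \<Longrightarrow> cross2 (V i) (V j) \<noteq> 0"
  shows "q = r"
proof
  fix v
  have "binary_cubic (\<lambda>v. q v + (-1) * r v)"
    using assms(1,2) by (intro binary_cubic_add binary_cubic_cmult)
  then have "q v + (-1) * r v = 0"
    by (rule binary_cubic_zero[where V = V]) (use assms(3,4) in auto)
  then show "q v = r v" by simp
qed

text \<open>Lagrange interpolation in homogeneous form: the factor x - x_j is replaced by the linear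
  form \<open>cross2 v (V j)\<close>, which vanishes exactly along the direction of a nonzero
  \<open>V j\<close>.\<close>

definition cubic_interpolant :: "(nat \<Rightarrow> plane) \<Rightarrow> (nat \<Rightarrow> real) \<Rightarrow> plane \<Rightarrow> real" where
  "cubic_interpolant V h v =
     (\<Sum>i<4. h i * (\<Prod>j\<in>{..<4} - {i}. cross2 v (V j) / cross2 (V i) (V j)))"

lemma binary_cubic_interpolant: "binary_cubic (cubic_interpolant V h)"
  unfolding cubic_interpolant_def
  by (intro binary_cubic_sum binary_cubic_cmult binary_cubic_prod_cross2) (simp add: card_Diff_singleton)

lemma cubic_interpolant_node:
  assumes "k < 4" "\<And>i j. i < 4 \<Longrightarrow> j < 4 \<Longrightarrow> i \<noteq> j \<Longrightarrow> cross2 (V i) (V j) \<noteq> 0"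
  shows "cubic_interpolant V h (V k) = h k"
proof -
  have "(\<Prod>j\<in>{..<4} - {i}. cross2 (V k) (V j) / cross2 (V i) (V j)) = (if i = k then 1 else 0)"
    if "i < 4" for i
  proof (cases "i = k")
    case True
    then show ?thesis using assms by (auto intro!: prod.neutral)
  next
    case False
    then show ?thesis using assms(1) by (auto intro!: bexI[of _ k])
  qed
  then have "cubic_interpolant V h (V k) = (\<Sum>i<4. if i = k then h i else 0)"
    unfolding cubic_interpolant_def by (intro sum.cong) auto
  then show ?thesis using assms(1) by simp
qed

lemma smooth_on_cubic_interpolant:
  fixes V :: "nat \<Rightarrow> 'a::real_normed_vector \<Rightarrow> plane"
  assumes "open S" "\<And>i. i < 4 \<Longrightarrow> smooth_on S (V i)" "\<And>i. i < 4 \<Longrightarrow> smooth_on S (h i)"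
    and "\<And>i j x. i < 4 \<Longrightarrow> j < 4 \<Longrightarrow> i \<noteq> j \<Longrightarrow> x \<in> S \<Longrightarrow> cross2 (V i x) (V j x) \<noteq> 0"
  shows "smooth_on S (\<lambda>x. cubic_interpolant (\<lambda>i. V i x) (\<lambda>i. h i x) v)"
  unfolding cubic_interpolant_def
  using assms
  by (intro smooth_on_sum smooth_on_mult smooth_on_prod smooth_on_divide smooth_on_cross2 smooth_on_const) auto

section \<open>Bilinear maps of the plane and their cubics\<close>

definition bilinear_with :: "(2 \<Rightarrow> 2 \<Rightarrow> plane) \<Rightarrow> plane \<Rightarrow> plane \<Rightarrow> plane" where
  "bilinear_with g u v = (\<Sum>i\<in>UNIV. \<Sum>j\<in>UNIV. (u $ i * v $ j) *\<^sub>R g i j)"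

lemma bilinear_with_2:
  "bilinear_with g u v = (u $ 1 * v $ 1) *\<^sub>R g 1 1 + (u $ 1 * v $ 2) *\<^sub>R g 1 2
     + (u $ 2 * v $ 1) *\<^sub>R g 2 1 + (u $ 2 * v $ 2) *\<^sub>R g 2 2"
  by (simp add: bilinear_with_def sum_2)

lemma bilinear_with_add_left:
  "bilinear_with g (u + u') v = bilinear_with g u v + bilinear_with g u' v"
  by (simp add: bilinear_with_2 algebra_simps)

lemma bilinear_with_add_right:
  "bilinear_with g u (v + v') = bilinear_with g u v + bilinear_with g u v'"
  by (simp add: bilinear_with_2 algebra_simps)

lemma bilinear_with_scaleR_left: "bilinear_with g (c *\<^sub>R u) v = c *\<^sub>R bilinear_with g u v"
  by (simp add: bilinear_with_2 algebra_simps)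

lemma bilinear_with_scaleR_right: "bilinear_with g u (c *\<^sub>R v) = c *\<^sub>R bilinear_with g u v"
  by (simp add: bilinear_with_2 algebra_simps)

lemma bilinear_with_axis: "bilinear_with g (axis i 1) (axis j 1) = g i j"
  using exhaust_2[of i] exhaust_2[of j] by (auto simp: bilinear_with_2 axis_def)

lemma bilinear_with_commute:
  "(\<And>i j. g i j = g j i) \<Longrightarrow> bilinear_with g u v = bilinear_with g v u"
  using exhaust_2 by (simp add: bilinear_with_2 mult.commute)

lemma binary_cubic_bilinear_with: "binary_cubic (\<lambda>v. cross2 v (bilinear_with g v v))"
  by (rule binary_cubicI[where a = "g 1 1 $ 2" and b = "g 1 2 $ 2 + g 2 1 $ 2 - g 1 1 $ 1"
        and c = "g 2 2 $ 2 - g 1 2 $ 1 - g 2 1 $ 1" and d = "- g 2 2 $ 1"])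
     (simp add: bilinear_with_2 cross2_def algebra_simps power2_eq_square power3_eq_cube)

text \<open>The trace of \<open>\<rho> u v + \<rho> v u\<close> over \<open>v\<close> is \<open>3 \<rho> u\<close>, which recovers \<open>\<rho>\<close> from the bilinear form.\<close>

definition trace_form :: "(2 \<Rightarrow> 2 \<Rightarrow> plane) \<Rightarrow> plane \<Rightarrow> real" where
  "trace_form g u = (\<Sum>i\<in>UNIV. \<Sum>j\<in>UNIV. u $ i * g i j $ j) / 3"

text \<open>A symmetric \<open>g\<close> has six components, and the four vanishing coefficients of
  the cubic leave two free, just as many as a linear form has. Testing at the axes kills the outer
  coefficients; testing at their sum and difference expresses \<open>g 1 1 $ 1\<close> and
  \<open>g 2 2 $ 2\<close> by the mixed components.\<close>

lemma bilinear_with_eq_trace_form: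
  assumes sym: "\<And>i j. g i j = g j i" and 0: "\<And>v. cross2 v (bilinear_with g v v) = 0"
  shows "bilinear_with g u v = trace_form g u *\<^sub>R v + trace_form g v *\<^sub>R u"
proof -
  have "g 1 1 $ 2 = 0" "g 2 2 $ 1 = 0"
    using 0[of "axis 1 1"] 0[of "axis 2 1"]
    by (simp_all add: bilinear_with_2 cross2_def axis_def)
  moreover have "g 1 1 $ 1 = 2 * g 1 2 $ 2" "g 2 2 $ 2 = 2 * g 1 2 $ 1"
    using 0[of "axis 1 1 + axis 2 1"] 0[of "axis 1 1 - axis 2 1"] calculation sym[of 2 1]
    by (simp_all add: bilinear_with_2 cross2_def axis_def)
  ultimately show ?thesis
    using sym[of 2 1]
    by (simp add: bilinear_with_2 trace_form_def sum_2 vec_eq_iff forall_2 field_simps)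
qed

text \<open>The coefficients of the symmetric bilinear map without mixed terms whose cubic \<open>v \<times> G(v,v)\<close> is \<open>q\<close>;
  they are read off from four values of \<open>q\<close>.\<close>

definition cubic_coeffs :: "(plane \<Rightarrow> real) \<Rightarrow> 2 \<Rightarrow> 2 \<Rightarrow> plane" where
  "cubic_coeffs q i j =
     (if i \<noteq> j then 0
      else if i = 1 then
        (q (axis 2 1) - (q (axis 1 1 + axis 2 1) - q (axis 1 1 - axis 2 1)) / 2) *\<^sub>R axis 1 1
          + q (axis 1 1) *\<^sub>R axis 2 1
      else - q (axis 2 1) *\<^sub>R axis 1 1
          + ((q (axis 1 1 + axis 2 1) + q (axis 1 1 - axis 2 1)) / 2 - q (axis 1 1)) *\<^sub>R axis 2 1)"

text \<open>Without mixed terms the coefficients of the cubic of \<open>g\<close> are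
  \<open>g 1 1 $ 2\<close>, \<open>- g 1 1 $ 1\<close>, \<open>g 2 2 $ 2\<close> and
  \<open>- g 2 2 $ 1\<close>, so each remaining component is, up to sign, one coefficient of
  \<open>q\<close>.\<close>

lemma cross2_cubic_coeffs:
  assumes "binary_cubic q"
  shows "cross2 v (bilinear_with (cubic_coeffs q) v v) = q v"
  by (subst binary_cubic_values[OF assms])
     (simp add: bilinear_with_2 cubic_coeffs_def cross2_def axis_def algebra_simps power2_eq_square power3_eq_cube)

section \<open>Curves in leaves\<close>

lemma has_vector_derivative_along:
  assumes "(\<gamma> has_vector_derivative w) (at t)" "(f has_derivative f') (at (\<gamma> t))"
  shows "((\<lambda>s. f (\<gamma> s)) has_vector_derivative f' w) (at t)"
proof -
  have "linear f'" using assms(2) has_derivative_linear by blast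
  then show ?thesis
    using has_derivative_compose[OF assms[unfolded has_vector_derivative_def]]
    by (simp add: has_vector_derivative_def linear_scale)
qed

lemma plane_expansion: "v = v $ 1 *\<^sub>R axis 1 1 + v $ 2 *\<^sub>R axis 2 1" for v :: plane
  by (simp add: vec_eq_iff forall_2 axis_def)

text \<open>The gradient turned by a right angle (the Hamiltonian field of \<open>f\<close>). The
  sign is chosen so that \<open>differential f p w = cross2 (tangent_field f p) w\<close>.\<close>

definition tangent_field :: "(plane \<Rightarrow> real) \<Rightarrow> plane \<Rightarrow> plane" where
  "tangent_field f p = differential f p (axis 2 1) *\<^sub>R axis 1 1 - differential f p (axis 1 1) *\<^sub>R axis 2 1"

text \<open>The second derivative as a quadratic form, D^2 f(v, v). Spelling it through the partial
  derivatives keeps to derivatives of functions with a fixed inner direction.\<close>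

definition hess :: "(plane \<Rightarrow> real) \<Rightarrow> plane \<Rightarrow> plane \<Rightarrow> real" where
  "hess f p v = (\<Sum>i\<in>UNIV. v $ i * differential (\<lambda>q. differential f q (axis i 1)) p v)"

lemma differential_expansion:
  fixes f :: "plane \<Rightarrow> 'b::real_normed_vector"
  assumes "smooth_on U f" "p \<in> U"
  shows "differential f p w = w $ 1 *\<^sub>R differential f p (axis 1 1) + w $ 2 *\<^sub>R differential f p (axis 2 1)"
proof -
  have "linear (differential f p)"
    using smooth_on_has_derivative[OF assms] has_derivative_linear by blast
  then show ?thesis
    by (subst plane_expansion[of w]) (simp only: linear_add linear_scale)
qed

lemma differential_eq_cross2:
  assumes "smooth_on U f" "p \<in> U"
  shows "differential f p w = cross2 (tangent_field f p) w"
  by (subst differential_expansion[OF assms]) (simp add: cross2_def tangent_field_def axis_def)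

lemma smooth_on_tangent_field: "open U \<Longrightarrow> smooth_on U f \<Longrightarrow> smooth_on U (tangent_field f)"
  unfolding tangent_field_def [abs_def]
  by (intro smooth_on_diff smooth_on_scaleR smooth_on_differential smooth_on_const)

text \<open>The direction \<open>X p\<close> moves with \<open>p\<close>, so it is expanded in the
  axes to return to the fixed directions that smoothness controls.\<close>

lemma smooth_on_differential_field:
  fixes f :: "plane \<Rightarrow> 'b::real_normed_vector"
  assumes "open U" "smooth_on U f" "smooth_on U X"
  shows "smooth_on U (\<lambda>p. differential f p (X p))"
proof (rule smooth_on_cong[OF assms(1)])
  show "smooth_on U (\<lambda>p. X p $ 1 *\<^sub>R differential f p (axis 1 1) + X p $ 2 *\<^sub>R differential f p (axis 2 1))"
    using assms by (intro smooth_on_add smooth_on_scaleR smooth_on_nth smooth_on_differential)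
qed (rule differential_expansion[OF assms(2), symmetric])

lemma smooth_on_hess:
  "open U \<Longrightarrow> smooth_on U f \<Longrightarrow> smooth_on U X \<Longrightarrow> smooth_on U (\<lambda>p. hess f p (X p))"
  unfolding hess_def
  by (intro smooth_on_sum smooth_on_mult smooth_on_nth smooth_on_differential_field smooth_on_differential)

lemma hess_scaleR:
  assumes "smooth_on U f" "p \<in> U"
  shows "hess f p (c *\<^sub>R v) = c\<^sup>2 * hess f p v"
proof -
  have "differential (\<lambda>q. differential f q w) p (c *\<^sub>R v) = c * differential (\<lambda>q. differential f q w) p v" for w
    using has_derivative_linear[OF smooth_on_has_derivative[OF smooth_on_differential[OF assms(1), of w] assms(2)]]
    by (simp add: linear_scale)
  then show ?thesis
    by (simp add: hess_def sum_2 power2_eq_square algebra_simps)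
qed

section \<open>Web functions along leaves\<close>

lemma tangent_field_nonzero:
  assumes "web_function \<F> U f" "p \<in> U"
  shows "tangent_field f p \<noteq> 0"
proof
  assume "tangent_field f p = 0"
  then have "differential f p = (\<lambda>v. 0)"
    using assms by (auto simp: fun_eq_iff differential_eq_cross2[of U] web_function_def cross2_def)
  with assms show False by (auto simp: web_function_def)
qed

text \<open>A connected piece of a leaf inside \<open>U\<close> stays in one plaque, and a plaque is
  a level set. Connectedness is essential: the leaf may return to \<open>U\<close> in another plaque
  with another value.\<close>

lemma web_function_eq_on_connected:
  assumes "web_function \<F> U f" "L \<in> \<F>" "connected A" "A \<subseteq> L \<inter> U" "x \<in> A" "y \<in> A"
  shows "f x = f y"
proof -
  let ?C = "connected_component_set (L \<inter> U) x"
  have "?C \<in> components (L \<inter> U)" using assms(4,5) by (auto intro: componentsI)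
  then obtain c where "?C = {p \<in> U. f p = c}"
    using assms(1,2) unfolding web_function_def by meson
  moreover have "A \<subseteq> ?C" using assms by (intro connected_component_maximal) auto
  ultimately show ?thesis using assms(5,6) by auto
qed

text \<open>The plaque of \<open>p\<close> is a full level set in \<open>U\<close>, necessarily the
  one at the value \<open>f p\<close>; it is therefore enough to parametrize a level set in order to
  move inside a leaf.\<close>

lemma level_set_subset_leaf:
  assumes "web_function \<F> U f" "L \<in> \<F>" "p \<in> L" "p \<in> U" "x \<in> U" "f x = f p"
  shows "x \<in> L"
proof -
  let ?C = "connected_component_set (L \<inter> U) p"
  have C: "?C \<in> components (L \<inter> U)" using assms by (auto intro: componentsI)
  then obtain c where c: "?C = {p \<in> U. f p = c}"
    using assms(1,2) unfolding web_function_def by meson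
  have "p \<in> ?C" using assms by simp
  then have "f p = c" unfolding c by simp
  then have "x \<in> ?C" unfolding c using assms by simp
  then show ?thesis using in_components_subset[OF C] by auto
qed

lemma regular_curve_open: "regular_curve I \<gamma> \<Longrightarrow> open I"
  by (simp add: regular_curve_def open_interval_def)

lemma regular_curve_has_velocity:
  "regular_curve I \<gamma> \<Longrightarrow> t \<in> I \<Longrightarrow> (\<gamma> has_vector_derivative velocity \<gamma> t) (at t)"
  unfolding velocity_def regular_curve_def by (blast intro: smooth_on_has_vector_derivative)

lemma regular_curve_smooth_velocity: "regular_curve I \<gamma> \<Longrightarrow> smooth_on I (velocity \<gamma>)"
  unfolding velocity_def [abs_def] regular_curve_def open_interval_def
  by (blast intro: smooth_on_vector_derivative)

text \<open>These are the first and second derivatives of f(c(t)) = const. Constancy is available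
  only near \<open>t\<close>, on a ball that the curve maps into \<open>U\<close>, since its
  connected image lies in one plaque.\<close>

lemma web_function_along_leaf:
  assumes web: "web_function \<F> U f" "L \<in> \<F>" and \<gamma>: "regular_curve I \<gamma>" "\<gamma> ` I \<subseteq> L"
    and t: "t \<in> I" "\<gamma> t \<in> U"
  shows "differential f (\<gamma> t) (velocity \<gamma> t) = 0" (is ?first)
    and "differential f (\<gamma> t) (vector_derivative (velocity \<gamma>) (at t)) = - hess f (\<gamma> t) (velocity \<gamma> t)" (is ?second)
proof -
  have U: "open U" "smooth_on U f" using web by (auto simp: web_function_def)
  have "continuous_on I \<gamma>" using \<gamma> by (simp add: regular_curve_def smooth_on_imp_continuous_on)
  then have "open (I \<inter> \<gamma> -` U)"
    using U(1) regular_curve_open[OF \<gamma>(1)] by (intro continuous_open_preimage)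
  then obtain e where e: "e > 0" "ball t e \<subseteq> I \<inter> \<gamma> -` U"
    using t by (meson IntI open_contains_ball vimageI)
  let ?B = "ball t e"
  have "connected (\<gamma> ` ?B)"
    using e(2) \<open>continuous_on I \<gamma>\<close> by (intro connected_continuous_image) (auto intro: continuous_on_subset)
  moreover have "\<gamma> ` ?B \<subseteq> L \<inter> U" using e(2) \<gamma>(2) by blast
  ultimately have const: "f (\<gamma> s) = f (\<gamma> t)" if "s \<in> ?B" for s
    by (rule web_function_eq_on_connected[OF web]) (use that e(1) in simp_all)
  have first: "differential f (\<gamma> s) (velocity \<gamma> s) = 0" if s: "s \<in> ?B" for s
  proof -
    have "((\<lambda>s. f (\<gamma> s)) has_vector_derivative differential f (\<gamma> s) (velocity \<gamma> s)) (at s)"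
      by (rule has_vector_derivative_along[OF regular_curve_has_velocity[OF \<gamma>(1)]
            smooth_on_has_derivative[OF U(2)]]) (use s e(2) in auto)
    moreover have "((\<lambda>s. f (\<gamma> s)) has_vector_derivative 0) (at s)"
      by (rule has_vector_derivative_transform_within_open[OF has_vector_derivative_const[of "f (\<gamma> t)"], where S = ?B])
         (use s const in auto)
    ultimately show ?thesis by (rule vector_derivative_unique_at)
  qed
  from first[of t] e(1) show ?first by simp
  let ?v = "velocity \<gamma>" and ?a = "vector_derivative (velocity \<gamma>) (at t)"
  let ?d = "\<lambda>i q. differential f q (axis i 1)"
  have v: "(?v has_vector_derivative ?a) (at t)"
    using smooth_on_has_vector_derivative[OF regular_curve_smooth_velocity[OF \<gamma>(1)] t(1)] .
  have v_nth: "((\<lambda>s. ?v s $ i) has_vector_derivative ?a $ i) (at t)" for i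
    by (rule bounded_linear.has_vector_derivative[OF bounded_linear_vec_nth v])
  have d: "((\<lambda>s. ?d i (\<gamma> s)) has_vector_derivative differential (?d i) (\<gamma> t) (?v t)) (at t)" for i
    by (rule has_vector_derivative_along[OF regular_curve_has_velocity[OF \<gamma>(1) t(1)]
          smooth_on_has_derivative[OF smooth_on_differential[OF U(2)] t(2)]])
  have "((\<lambda>s. \<Sum>i\<in>UNIV. ?v s $ i * ?d i (\<gamma> s)) has_vector_derivative
      (\<Sum>i\<in>UNIV. ?v t $ i * differential (?d i) (\<gamma> t) (?v t) + ?a $ i * ?d i (\<gamma> t))) (at t)"
    by (intro has_vector_derivative_sum has_vector_derivative_mult v_nth d)
  moreover have "(\<Sum>i\<in>UNIV. ?v s $ i * ?d i (\<gamma> s)) = 0" if "s \<in> ?B" for s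
    using first[OF that] that e(2) differential_expansion[OF U(2), of "\<gamma> s" "?v s"]
    by (auto simp: sum_2)
  then have "((\<lambda>s. \<Sum>i\<in>UNIV. ?v s $ i * ?d i (\<gamma> s)) has_vector_derivative 0) (at t)"
    using e(1) by (intro has_vector_derivative_transform_within_open[OF has_vector_derivative_const[of 0], where S = ?B]) auto
  ultimately have "(\<Sum>i\<in>UNIV. ?v t $ i * differential (?d i) (\<gamma> t) (?v t) + ?a $ i * ?d i (\<gamma> t)) = 0"
    by (rule vector_derivative_unique_at)
  then show ?second
    using differential_expansion[OF U(2) t(2), of ?a] by (simp add: hess_def sum_2)
qed

text \<open>The velocity lies in the kernel of the differential, which \<open>tangent_field\<close>
  spans. Of the three factors \<open>s\<close>, one comes from the velocity in the cross product and
  two from the quadratic Hessian. A cubic satisfying the geodesic equation must therefore take the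
  value \<open>hess\<close> at the tangent field, whatever the parametrization.\<close>

lemma leaf_velocity:
  assumes web: "web_function \<F> U f" "L \<in> \<F>" and \<gamma>: "regular_curve I \<gamma>" "\<gamma> ` I \<subseteq> L"
    and t: "t \<in> I" "\<gamma> t \<in> U"
  obtains s where "s \<noteq> 0" "velocity \<gamma> t = s *\<^sub>R tangent_field f (\<gamma> t)"
    "cross2 (velocity \<gamma> t) (vector_derivative (velocity \<gamma>) (at t))
       = - (s ^ 3 * hess f (\<gamma> t) (tangent_field f (\<gamma> t)))"
proof -
  have U: "smooth_on U f" using web by (auto simp: web_function_def)
  note along = web_function_along_leaf[OF assms]
  define s where "s = (velocity \<gamma> t \<bullet> tangent_field f (\<gamma> t)) / (tangent_field f (\<gamma> t) \<bullet> tangent_field f (\<gamma> t))"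
  have v: "velocity \<gamma> t = s *\<^sub>R tangent_field f (\<gamma> t)" unfolding s_def
    using along(1) tangent_field_nonzero[OF web(1) t(2)]
    by (intro cross2_eq_0D) (auto simp: differential_eq_cross2[OF U t(2)])
  moreover have "velocity \<gamma> t \<noteq> 0" using \<gamma>(1) t(1) by (simp add: regular_curve_def)
  then have "s \<noteq> 0" using v by auto
  moreover have "cross2 (velocity \<gamma> t) (vector_derivative (velocity \<gamma>) (at t))
       = s * (- hess f (\<gamma> t) (velocity \<gamma> t))"
    unfolding along(2)[symmetric] differential_eq_cross2[OF U t(2)] by (subst v) simp
  ultimately show ?thesis
    using that[of s] by (simp add: hess_scaleR[OF U t(2)] power2_eq_square power3_eq_cube)
qed

text \<open>Makes the geodesic condition effective at every point. The map \<Phi> has components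
  \<open>f x\<close> and \<open>x \<bullet> V p\<close>; its differential at \<open>p\<close> is
  injective, because the kernel of the differential of \<open>f\<close> is spanned by
  \<open>V p\<close>, on which the second component does not vanish. The local inverse of \<Phi>
  carries a coordinate line to a piece of the level set through \<open>p\<close>.\<close>

lemma leaf_curve_through:
  assumes web: "web_function \<F> U f" "L \<in> \<F>" and p: "p \<in> L" "p \<in> U"
  obtains I \<gamma> t where "regular_curve I \<gamma>" "\<gamma> ` I \<subseteq> L" "t \<in> I" "\<gamma> t = p"
proof -
  have U: "open U" "smooth_on U f" using web by (auto simp: web_function_def)
  define V where "V = tangent_field f"
  have V: "smooth_on U V" unfolding V_def by (rule smooth_on_tangent_field[OF U])
  have Vp: "V p \<noteq> 0" unfolding V_def by (rule tangent_field_nonzero[OF web(1) p(2)])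
  \<comment> \<open>On \<open>U0\<close> the tangent field keeps a positive component along
    \<open>V p\<close>, so that component can be divided by when normalising the field.\<close>
  define U0 where "U0 = U \<inter> (\<lambda>x. V x \<bullet> V p) -` {0<..}"
  have "open U0" unfolding U0_def
    by (intro continuous_open_preimage U open_greaterThan continuous_on_inner
        smooth_on_imp_continuous_on V continuous_on_const)
  have U0: "x \<in> U" "V x \<bullet> V p > 0" if "x \<in> U0" for x using that by (auto simp: U0_def)
  have pU0: "p \<in> U0" using p Vp by (simp add: U0_def)
  let ?e1 = "axis 1 1 :: plane" and ?e2 = "axis 2 1 :: plane"
  define \<Phi> where "\<Phi> x = f x *\<^sub>R ?e1 + (x \<bullet> V p) *\<^sub>R ?e2" for x
  define \<Phi>' where "\<Phi>' x w = differential f x w *\<^sub>R ?e1 + (w \<bullet> V p) *\<^sub>R ?e2" for x w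
  have der: "(\<Phi> has_derivative \<Phi>' x) (at x)" if "x \<in> U" for x
    unfolding \<Phi>_def[abs_def] \<Phi>'_def[abs_def]
    by (intro has_derivative_add has_derivative_scaleR_left has_derivative_inner_left
        smooth_on_has_derivative[OF U(2) that] has_derivative_ident)
  have bl: "bounded_linear (\<Phi>' x)" if "x \<in> U" for x
    using der[OF that] has_derivative_bounded_linear by blast
  have \<Phi>'_eq_0: "w = 0" if "\<Phi>' p w = 0" for w
  proof -
    have *: "cross2 (V p) w = 0" "w \<bullet> V p = 0"
      using that unfolding \<Phi>'_def V_def differential_eq_cross2[OF U(2) p(2)]
      by (auto simp: vec_eq_iff forall_2 axis_def)
    show ?thesis using cross2_eq_0D[OF *(1) Vp] *(2) by simp
  qed
  have lin: "linear (\<Phi>' p)" using bl[OF p(2)] by (rule bounded_linear.linear)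
  then have "inj (\<Phi>' p)" using \<Phi>'_eq_0 by (simp add: linear_injective_0)
  then obtain h where h: "linear h" "h \<circ> \<Phi>' p = id"
    using linear_injective_left_inverse[OF lin] by blast
  then have h': "bounded_linear h" by (simp add: linear_conv_bounded_linear)
  obtain U' V' g g' where IFT: "open U'" "U' \<subseteq> U0" "p \<in> U'" "open V'" "\<Phi> p \<in> V'"
      "homeomorphism U' V' \<Phi> g"
      "\<And>y. y \<in> V' \<Longrightarrow> (g has_derivative g' y) (at y)"
      "\<And>y. y \<in> V' \<Longrightarrow> g' y = inv (blinfun_apply (Blinfun (\<Phi>' (g y))))"
      "\<And>y. y \<in> V' \<Longrightarrow> bij (blinfun_apply (Blinfun (\<Phi>' (g y))))"
  proof (rule inverse_function_theorem[OF \<open>open U0\<close> _ _ pU0, of \<Phi> "\<lambda>x. Blinfun (\<Phi>' x)" "Blinfun h"])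
    show "(\<Phi> has_derivative blinfun_apply (Blinfun (\<Phi>' x))) (at x)" if "x \<in> U0" for x
      using U0[OF that] der bl by (simp add: bounded_linear_Blinfun_apply)
    show "continuous_on U0 (\<lambda>x. Blinfun (\<Phi>' x))"
    proof (rule continuous_on_blinfun_componentwise)
      fix i :: plane
      have "continuous_on U0 (\<lambda>x. differential f x i)"
        by (rule continuous_on_subset[OF smooth_on_imp_continuous_on[OF smooth_on_differential[OF U(2)]]])
           (use U0 in auto)
      then have "continuous_on U0 (\<lambda>x. \<Phi>' x i)"
        unfolding \<Phi>'_def by (intro continuous_intros)
      then show "continuous_on U0 (\<lambda>x. blinfun_apply (Blinfun (\<Phi>' x)) i)"
        by (rule continuous_on_eq) (use U0 bl in \<open>simp add: bounded_linear_Blinfun_apply\<close>)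
    qed
    show "Blinfun h o\<^sub>L Blinfun (\<Phi>' p) = id_blinfun"
      using h(2) by (intro blinfun_eqI)
        (simp add: bounded_linear_Blinfun_apply[OF h'] bounded_linear_Blinfun_apply[OF bl[OF p(2)]] fun_eq_iff)
  qed blast
  have gU: "g y \<in> U'" "\<Phi> (g y) = y" if "y \<in> V'" for y
    using IFT(6) that by (auto simp: homeomorphism_def)
  \<comment> \<open>In the coordinates \<Phi> the level set is the line with first coordinate
    \<open>f p\<close>; \<open>t0\<close> is the parameter at which it passes through \<Phi>
    p.\<close>
  define y where "y t = f p *\<^sub>R ?e1 + t *\<^sub>R ?e2" for t :: real
  have y_der: "(y has_vector_derivative ?e2) (at t)" for t
    unfolding y_def[abs_def] by (auto intro!: derivative_eq_intros)
  define t0 where "t0 = p \<bullet> V p"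
  have yt0: "y t0 = \<Phi> p" by (simp add: y_def \<Phi>_def t0_def)
  have "continuous_on UNIV y" unfolding y_def[abs_def] by (intro continuous_intros)
  then have "open (y -` V')" using IFT(4) by (simp add: continuous_on_open_vimage)
  then obtain e where e: "e > 0" "ball t0 e \<subseteq> y -` V'"
    using IFT(5) yt0 by (metis open_contains_ball vimageI)
  define I where "I = ball t0 e"
  define \<gamma> where "\<gamma> t = g (y t)" for t
  have I: "open_interval I"
    using e(1) by (auto simp: I_def open_interval_def is_interval_convex_1)
  have yI: "y t \<in> V'" if "t \<in> I" for t using that e by (auto simp: I_def)
  have \<gamma>U: "\<gamma> t \<in> U0" if "t \<in> I" for t
    using gU(1)[OF yI[OF that]] IFT(2) by (auto simp: \<gamma>_def)
  \<comment> \<open>The tangent field rescaled so that \<open>x \<bullet> V p\<close> grows at unit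
    speed; the differential of \<Phi> then sends it to the second axis, the velocity of the line.
    The inverse function theorem yields only differentiability of \<gamma>, and the equation
    \<gamma>' = X(\<gamma>) upgrades this to smoothness.\<close>
  define X where "X x = inverse (V x \<bullet> V p) *\<^sub>R V x" for x
  have X: "smooth_on U0 X" unfolding X_def[abs_def]
    using U0 smooth_on_subset[OF V, of U0] \<open>open U0\<close>
    by (intro smooth_on_scaleR smooth_on_inverse smooth_on_inner smooth_on_const) (auto simp: less_le)
  have \<gamma>_der: "(\<gamma> has_vector_derivative X (\<gamma> t)) (at t)" if t: "t \<in> I" for t
  proof -
    have \<gamma>t: "\<gamma> t \<in> U" using U0(1)[OF \<gamma>U[OF t]] .
    have app: "blinfun_apply (Blinfun (\<Phi>' (\<gamma> t))) = \<Phi>' (\<gamma> t)"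
      using bl[OF \<gamma>t] by (rule bounded_linear_Blinfun_apply)
    have "\<Phi>' (\<gamma> t) (X (\<gamma> t)) = ?e2"
      using U0(2)[OF \<gamma>U[OF t]]
      unfolding \<Phi>'_def differential_eq_cross2[OF U(2) \<gamma>t] V_def[symmetric] X_def by simp
    then have "inv (\<Phi>' (\<gamma> t)) ?e2 = X (\<gamma> t)"
      using IFT(9)[OF yI[OF t]] app unfolding \<gamma>_def by (metis bij_inv_eq_iff)
    then have "g' (y t) ?e2 = X (\<gamma> t)"
      using IFT(8)[OF yI[OF t]] app unfolding \<gamma>_def by simp
    then show ?thesis
      using has_vector_derivative_along[OF y_der IFT(7)[OF yI[OF t]]] by (simp add: \<gamma>_def[abs_def])
  qed
  have smooth: "smooth_on I \<gamma>"
    by (rule smooth_on_autonomous_ode[OF _ X _ \<gamma>_der]) (use \<gamma>U in \<open>auto simp: I_def\<close>)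
  have "X x \<noteq> 0" if "x \<in> U0" for x
    using U0(2)[OF that] by (auto simp: X_def)
  then have "regular_curve I \<gamma>"
    unfolding regular_curve_def velocity_def
    using I smooth \<gamma>U vector_derivative_at[OF \<gamma>_der] by simp
  moreover have "\<gamma> ` I \<subseteq> L"
  proof
    fix x assume "x \<in> \<gamma> ` I"
    then obtain t where t: "t \<in> I" "x = \<gamma> t" by blast
    have "\<Phi> x = y t" using gU(2)[OF yI[OF t(1)]] t(2) by (simp add: \<gamma>_def)
    then have "\<Phi> x $ 1 = y t $ 1" by simp
    then have "f x = f p" by (simp add: \<Phi>_def y_def axis_def)
    then show "x \<in> L"
      using U0(1)[OF \<gamma>U[OF t(1)]] t(2) by (intro level_set_subset_leaf[OF web p]) auto
  qed
  moreover have "t0 \<in> I" using e(1) by (simp add: I_def)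
  moreover have "\<gamma> t0 = p" using IFT(3,6) by (simp add: \<gamma>_def yt0 homeomorphism_def)
  ultimately show ?thesis by (rule that)
qed

section \<open>Christoffel symbols and the projective cubic\<close>

definition christoffel :: "plane set \<Rightarrow> connection \<Rightarrow> plane \<Rightarrow> 2 \<Rightarrow> 2 \<Rightarrow> plane" where
  "christoffel D nabla p i j = nabla (coordinate_field D i) (coordinate_field D j) p"

lemma coordinate_field_has_derivative:
  assumes "open D" "p \<in> D"
  shows "(coordinate_field D i has_derivative (\<lambda>v. 0)) (at p)"
  by (rule has_derivative_transform_within_open[OF has_derivative_const assms])
     (simp add: coordinate_field_def)

lemma coordinate_field_vector_field: "open D \<Longrightarrow> coordinate_field D i \<in> vector_fields D"
  by (auto simp: vector_fields_def coordinate_field_def intro: smooth_on_cong[OF _ _ smooth_on_const])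

lemma vector_fields_smooth: "X \<in> vector_fields D \<Longrightarrow> smooth_on D X"
  by (simp add: vector_fields_def)

lemma vector_fields_scaleR:
  "open D \<Longrightarrow> smooth_on D h \<Longrightarrow> X \<in> vector_fields D \<Longrightarrow> (\<lambda>q. h q *\<^sub>R X q) \<in> vector_fields D"
  by (simp add: vector_fields_def smooth_on_scaleR)

lemma vector_fields_add:
  "open D \<Longrightarrow> X \<in> vector_fields D \<Longrightarrow> Y \<in> vector_fields D \<Longrightarrow> (\<lambda>q. X q + Y q) \<in> vector_fields D"
  by (simp add: vector_fields_def smooth_on_add)

text \<open>An equality of functions on the whole plane, since both sides vanish off
  \<open>D\<close>. Only so can it be substituted into \<open>nabla\<close>, which takes entire
  fields as arguments.\<close>

lemma vector_field_coordinates: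
  assumes "X \<in> vector_fields D"
  shows "X = (\<lambda>q. X q $ 1 *\<^sub>R coordinate_field D 1 q + X q $ 2 *\<^sub>R coordinate_field D 2 q)"
proof
  fix q
  show "X q = X q $ 1 *\<^sub>R coordinate_field D 1 q + X q $ 2 *\<^sub>R coordinate_field D 2 q"
    using assms plane_expansion[of "X q"] by (cases "q \<in> D") (auto simp: coordinate_field_def vector_fields_def)
qed

text \<open>The coordinate frame is defined on all of \<open>D\<close>. Expanding both fields in it,
  additivity and homogeneity in the first argument and the Leibniz rule in the second leave only the
  Christoffel symbols and the componentwise derivative of \<open>Y\<close>.\<close>

lemma affine_connection_coordinates:
  assumes D: "open D" and conn: "affine_connection D nabla"
    and X: "X \<in> vector_fields D" and Y: "Y \<in> vector_fields D" and p: "p \<in> D"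
  shows "nabla X Y p = differential Y p (X p) + bilinear_with (christoffel D nabla p) (X p) (Y p)"
proof -
  let ?E = "coordinate_field D"
  note E = coordinate_field_vector_field[OF D]
  have add: "nabla (\<lambda>q. X q + Y q) Z p = nabla X Z p + nabla Y Z p"
    "nabla Z (\<lambda>q. X q + Y q) p = nabla Z X p + nabla Z Y p"
    if "X \<in> vector_fields D" "Y \<in> vector_fields D" "Z \<in> vector_fields D" for X Y Z
    using conn that p unfolding affine_connection_def by blast+
  have scale: "nabla (\<lambda>q. h q *\<^sub>R X q) Y p = h p *\<^sub>R nabla X Y p"
    "nabla X (\<lambda>q. h q *\<^sub>R Y q) p = h p *\<^sub>R nabla X Y p + differential h p (X p) *\<^sub>R Y p"
    if "X \<in> vector_fields D" "Y \<in> vector_fields D" "smooth_on D h" for X Y and h :: "plane \<Rightarrow> real"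
    using conn that p unfolding affine_connection_def by blast+
  have nth: "smooth_on D (\<lambda>q. Z q $ i)" if "Z \<in> vector_fields D" for Z i
    using D that by (intro smooth_on_nth vector_fields_smooth)
  have dY: "differential (\<lambda>q. Y q $ j) p w = differential Y p w $ j" for j w
    using bounded_linear.has_derivative[OF bounded_linear_vec_nth
        smooth_on_has_derivative[OF vector_fields_smooth[OF Y] p], of j]
    by (simp add: frechet_derivative_eqI)
  have Ep: "?E i p = axis i 1" for i using p by (simp add: coordinate_field_def)
  have "nabla X Y p = nabla (\<lambda>q. X q $ 1 *\<^sub>R ?E 1 q + X q $ 2 *\<^sub>R ?E 2 q) Y p"
    using vector_field_coordinates[OF X] by simp
  also have "\<dots> = X p $ 1 *\<^sub>R nabla (?E 1) Y p + X p $ 2 *\<^sub>R nabla (?E 2) Y p"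
    by (simp add: add scale vector_fields_scaleR D E nth X Y)
  finally have 1: "nabla X Y p = X p $ 1 *\<^sub>R nabla (?E 1) Y p + X p $ 2 *\<^sub>R nabla (?E 2) Y p" .
  have 2: "nabla (?E i) Y p = differential Y p (axis i 1)
      + (Y p $ 1 *\<^sub>R christoffel D nabla p i 1 + Y p $ 2 *\<^sub>R christoffel D nabla p i 2)" for i
  proof -
    have "nabla (?E i) Y p = nabla (?E i) (\<lambda>q. Y q $ 1 *\<^sub>R ?E 1 q + Y q $ 2 *\<^sub>R ?E 2 q) p"
      using vector_field_coordinates[OF Y] by simp
    also have "\<dots> = Y p $ 1 *\<^sub>R christoffel D nabla p i 1 + differential Y p (axis i 1) $ 1 *\<^sub>R axis 1 1
        + (Y p $ 2 *\<^sub>R christoffel D nabla p i 2 + differential Y p (axis i 1) $ 2 *\<^sub>R axis 2 1)"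
      by (simp add: add scale vector_fields_scaleR D E nth Y dY Ep christoffel_def)
    finally show ?thesis
      by (subst plane_expansion[of "differential Y p (axis i 1)"]) (simp add: algebra_simps)
  qed
  show ?thesis
    unfolding 1 2 bilinear_with_2
    by (subst differential_expansion[OF vector_fields_smooth[OF Y] p]) (simp add: algebra_simps)
qed

lemma affine_connection_vector_field:
  assumes "affine_connection D nabla" "X \<in> vector_fields D" "Y \<in> vector_fields D"
  shows "nabla X Y \<in> vector_fields D"
proof -
  have "nabla \<in> vector_fields D \<rightarrow>\<^sub>E vector_fields D \<rightarrow>\<^sub>E vector_fields D"
    using assms(1) by (simp only: affine_connection_def)
  from PiE_mem[OF PiE_mem[OF this assms(2)] assms(3)] show ?thesis .
qed

lemma smooth_on_christoffel:
  "open D \<Longrightarrow> affine_connection D nabla \<Longrightarrow> smooth_on D (\<lambda>p. christoffel D nabla p i j)"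
  unfolding christoffel_def
  using vector_fields_smooth affine_connection_vector_field coordinate_field_vector_field by blast

lemma christoffel_commute:
  assumes "open D" "torsion_free D nabla" "p \<in> D"
  shows "christoffel D nabla p i j = christoffel D nabla p j i"
proof -
  have "lie_bracket (coordinate_field D i) (coordinate_field D j) p = 0"
    by (simp add: lie_bracket_def frechet_derivative_eqI[OF coordinate_field_has_derivative[OF assms(1,3)]])
  moreover have "christoffel D nabla p i j - christoffel D nabla p j i
      = lie_bracket (coordinate_field D i) (coordinate_field D j) p"
    using assms coordinate_field_vector_field[OF assms(1)] unfolding torsion_free_def christoffel_def by blast
  ultimately show ?thesis by simp
qed

text \<open>The restricted abstractions and the value 0 off \<open>D\<close> match the normalisation
  of connections and vector fields, which membership in the extensional function space
  demands.\<close>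

definition connection_of :: "plane set \<Rightarrow> (plane \<Rightarrow> 2 \<Rightarrow> 2 \<Rightarrow> plane) \<Rightarrow> connection" where
  "connection_of D g = (\<lambda>X\<in>vector_fields D. \<lambda>Y\<in>vector_fields D. \<lambda>p.
     if p \<in> D then differential Y p (X p) + bilinear_with (g p) (X p) (Y p) else 0)"

lemma connection_of_apply:
  "X \<in> vector_fields D \<Longrightarrow> Y \<in> vector_fields D \<Longrightarrow> p \<in> D \<Longrightarrow>
     connection_of D g X Y p = differential Y p (X p) + bilinear_with (g p) (X p) (Y p)"
  by (simp add: connection_of_def)

lemma smooth_on_bilinear_with:
  "open D \<Longrightarrow> (\<And>i j. smooth_on D (\<lambda>p. g p i j)) \<Longrightarrow> smooth_on D X \<Longrightarrow> smooth_on D Y \<Longrightarrow>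
     smooth_on D (\<lambda>p. bilinear_with (g p) (X p) (Y p))"
  unfolding bilinear_with_def
  by (intro smooth_on_sum smooth_on_scaleR smooth_on_mult smooth_on_nth)

lemma affine_connection_connection_of:
  assumes D: "open D" and g: "\<And>i j. smooth_on D (\<lambda>p. g p i j)"
  shows "affine_connection D (connection_of D g)"
proof -
  have closed: "connection_of D g X Y \<in> vector_fields D"
    if X: "X \<in> vector_fields D" and Y: "Y \<in> vector_fields D" for X Y
  proof -
    have "smooth_on D (\<lambda>p. differential Y p (X p) + bilinear_with (g p) (X p) (Y p))"
      by (intro D g vector_fields_smooth X Y smooth_on_add smooth_on_bilinear_with smooth_on_differential_field)
    then have "smooth_on D (connection_of D g X Y)"
      by (rule smooth_on_cong[OF D, rotated]) (simp add: connection_of_apply X Y)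
    moreover have "connection_of D g X Y p = 0" if "p \<notin> D" for p
      using that X Y by (simp add: connection_of_def)
    ultimately show ?thesis unfolding vector_fields_def by blast
  qed
  have lin: "linear (differential Y p)" if "Y \<in> vector_fields D" "p \<in> D" for Y p
    using smooth_on_has_derivative[OF vector_fields_smooth[OF that(1)] that(2)] has_derivative_linear by blast
  have dadd: "differential (\<lambda>q. X q + Y q) p v = differential X p v + differential Y p v"
    if "X \<in> vector_fields D" "Y \<in> vector_fields D" "p \<in> D" for X Y p v
    using that
    by (intro fun_cong[OF frechet_derivative_eqI]) (auto intro!: has_derivative_add smooth_on_has_derivative vector_fields_smooth)
  have dscale: "differential (\<lambda>q. h q *\<^sub>R Y q) p v = h p *\<^sub>R differential Y p v + differential h p v *\<^sub>R Y p"
    if "smooth_on D h" "Y \<in> vector_fields D" "p \<in> D" for h Y p v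
    using that
    by (intro fun_cong[OF frechet_derivative_eqI]) (auto intro!: has_derivative_scaleR smooth_on_has_derivative vector_fields_smooth)
  show ?thesis
    unfolding affine_connection_def
  proof (intro conjI ballI allI impI)
    show "connection_of D g \<in> vector_fields D \<rightarrow>\<^sub>E vector_fields D \<rightarrow>\<^sub>E vector_fields D"
      using closed by (auto simp: connection_of_def)
  qed (simp_all add: connection_of_apply vector_fields_add vector_fields_scaleR D dadd dscale lin
      linear_add linear_scale bilinear_with_add_left bilinear_with_add_right
      bilinear_with_scaleR_left bilinear_with_scaleR_right algebra_simps)
qed

lemma christoffel_connection_of:
  assumes "open D" "p \<in> D"
  shows "christoffel D (connection_of D g) p = g p"
  using coordinate_field_vector_field[OF assms(1)] assms(2)
  by (simp add: fun_eq_iff christoffel_def connection_of_apply bilinear_with_axis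
      frechet_derivative_eqI[OF coordinate_field_has_derivative[OF assms]])
     (simp add: coordinate_field_def bilinear_with_axis)

lemma torsion_free_connection_of:
  assumes "\<And>p i j. p \<in> D \<Longrightarrow> g p i j = g p j i"
  shows "torsion_free D (connection_of D g)"
  unfolding torsion_free_def
proof (intro ballI)
  fix X Y p assume "X \<in> vector_fields D" "Y \<in> vector_fields D" "p \<in> D"
  then show "connection_of D g X Y p - connection_of D g Y X p = lie_bracket X Y p"
    using bilinear_with_commute[of "g p" "X p" "Y p"] assms by (simp add: connection_of_apply lie_bracket_def)
qed

section \<open>Projective classes and their cubics\<close>

definition projective_relation :: "plane set \<Rightarrow> (connection \<times> connection) set" where
  "projective_relation D = {(nabla, nabla'). nabla \<in> torsion_free_connections D \<and>
     nabla' \<in> torsion_free_connections D \<and> projectively_equivalent D nabla nabla'}"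

lemma projective_structures_eq:
  "projective_structures D = torsion_free_connections D // projective_relation D"
  by (simp add: projective_structures_def projective_relation_def)

text \<open>By antisymmetry of \<open>cross2\<close>, this cubic form only depends on the projective class.\<close>

definition projective_cubic :: "plane set \<Rightarrow> connection \<Rightarrow> plane \<Rightarrow> plane \<Rightarrow> real" where
  "projective_cubic D nabla p v = cross2 v (bilinear_with (christoffel D nabla p) v v)"

lemma binary_cubic_projective_cubic: "binary_cubic (projective_cubic D nabla p)"
  unfolding projective_cubic_def [abs_def] by (rule binary_cubic_bilinear_with)

lemma bilinear_with_diff:
  "bilinear_with g u v - bilinear_with h u v = bilinear_with (\<lambda>i j. g i j - h i j) u v"
  by (simp add: bilinear_with_2 algebra_simps)

text \<open>On the diagonal, projective equivalence changes the Christoffel map by a multiple of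
  \<open>v\<close>, which the determinant with \<open>v\<close> kills. Conversely, equal cubics make
  the cubic of the difference vanish, and the trace of the difference then supplies the smooth
  one-form.\<close>

lemma projectively_equivalent_iff_cubic:
  assumes D: "open D" and nabla: "nabla \<in> torsion_free_connections D" "nabla' \<in> torsion_free_connections D"
  shows "projectively_equivalent D nabla nabla' \<longleftrightarrow>
    (\<forall>p\<in>D. projective_cubic D nabla p = projective_cubic D nabla' p)"
proof
  note E = coordinate_field_vector_field[OF D]
  assume "projectively_equivalent D nabla nabla'"
  then obtain \<rho> where lin: "\<And>p. p \<in> D \<Longrightarrow> linear (\<rho> p)"
    and \<rho>: "\<And>X Y p. X \<in> vector_fields D \<Longrightarrow> Y \<in> vector_fields D \<Longrightarrow> p \<in> D \<Longrightarrow>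
      nabla X Y p - nabla' X Y p = \<rho> p (X p) *\<^sub>R Y p + \<rho> p (Y p) *\<^sub>R X p"
    unfolding projectively_equivalent_def one_form_def by blast
  show "\<forall>p\<in>D. projective_cubic D nabla p = projective_cubic D nabla' p"
  proof (intro ballI ext)
    fix p v assume p: "p \<in> D"
    define r where "r i = \<rho> p (axis i 1)" for i
    have diff: "christoffel D nabla p i j - christoffel D nabla' p i j = r i *\<^sub>R axis j 1 + r j *\<^sub>R axis i 1" for i j
      using \<rho>[OF E[of i] E[of j] p] p by (simp add: christoffel_def coordinate_field_def r_def)
    have "projective_cubic D nabla p v - projective_cubic D nabla' p v
       = cross2 v (bilinear_with (\<lambda>i j. r i *\<^sub>R axis j 1 + r j *\<^sub>R axis i 1) v v)"
      unfolding projective_cubic_def cross2_diff_right[symmetric] bilinear_with_diff diff ..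
    \<comment> \<open>The bilinear map takes the value 2 (v1 r1 + v2 r2) v at the pair (v,
      v).\<close>
    also have "\<dots> = 0"
      by (simp add: bilinear_with_2 cross2_def axis_def algebra_simps)
    finally show "projective_cubic D nabla p v = projective_cubic D nabla' p v" by simp
  qed
next
  assume eq: "\<forall>p\<in>D. projective_cubic D nabla p = projective_cubic D nabla' p"
  have conn: "affine_connection D nabla" "affine_connection D nabla'"
    and tf: "torsion_free D nabla" "torsion_free D nabla'"
    using nabla by (auto simp: torsion_free_connections_def)
  define g where "g p i j = christoffel D nabla p i j - christoffel D nabla' p i j" for p i j
  show "projectively_equivalent D nabla nabla'"
    unfolding projectively_equivalent_def
  proof (intro exI[of _ "\<lambda>p. trace_form (g p)"] conjI ballI)
    have g_smooth: "smooth_on D (\<lambda>p. g p i j)" for i j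
      unfolding g_def by (intro D smooth_on_diff smooth_on_christoffel conn)
    have "smooth_on D (\<lambda>p. trace_form (g p) v)" for v
      unfolding trace_form_def
      by (intro D g_smooth smooth_on_divide smooth_on_sum smooth_on_mult smooth_on_nth smooth_on_const) auto
    moreover have "linear (trace_form h)" for h
      by (rule linearI) (simp_all add: trace_form_def sum_2 field_simps)
    ultimately show "one_form D (\<lambda>p. trace_form (g p))" by (simp add: one_form_def)
  next
    fix X Y p assume X: "X \<in> vector_fields D" and Y: "Y \<in> vector_fields D" and p: "p \<in> D"
    have "cross2 v (bilinear_with (g p) v v) = 0" for v
    proof -
      have "projective_cubic D nabla p v = projective_cubic D nabla' p v" using eq p by simp
      then show ?thesis
        by (simp add: projective_cubic_def g_def[abs_def] bilinear_with_diff[symmetric] cross2_diff_right)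
    qed
    moreover have "g p i j = g p j i" for i j
      using christoffel_commute[OF D tf(1) p, of i j] christoffel_commute[OF D tf(2) p, of i j] by (simp add: g_def)
    ultimately have "bilinear_with (g p) (X p) (Y p) =
        trace_form (g p) (X p) *\<^sub>R Y p + trace_form (g p) (Y p) *\<^sub>R X p"
      by (intro bilinear_with_eq_trace_form)
    then show "nabla X Y p - nabla' X Y p =
        trace_form (g p) (X p) *\<^sub>R Y p + trace_form (g p) (Y p) *\<^sub>R X p"
      by (simp add: affine_connection_coordinates[OF D _ X Y p] conn g_def[abs_def] bilinear_with_diff[symmetric])
  qed
qed

text \<open>Through the cubic, the relation becomes equality of an invariant, from which the three
  laws are immediate.\<close>

lemma equiv_projective_relation:
  assumes "open D"
  shows "equiv (torsion_free_connections D) (projective_relation D)"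
proof -
  have "projective_relation D = {(nabla, nabla'). nabla \<in> torsion_free_connections D \<and>
     nabla' \<in> torsion_free_connections D \<and>
     (\<forall>p\<in>D. projective_cubic D nabla p = projective_cubic D nabla' p)}"
    unfolding projective_relation_def using projectively_equivalent_iff_cubic[OF assms] by blast
  then show ?thesis
    by (auto intro!: equivI refl_onI symI transI)
qed

section \<open>Unparametrized geodesics\<close>

lemma antiderivative_on_open_interval:
  fixes f :: "real \<Rightarrow> real"
  assumes I: "open_interval I" and f: "continuous_on I f"
  obtains F where "\<And>t. t \<in> I \<Longrightarrow> (F has_real_derivative f t) (at t)"
proof -
  have "open I" "is_interval I" "I \<noteq> {}" using I by (auto simp: open_interval_def)
  \<comment> \<open>The interval may be unbounded, so its end points are taken in the extended
    reals. Openness of \<open>I\<close> ensures that they are not attained.\<close>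
  define a b where "a = (INF t\<in>I. ereal t)" and "b = (SUP t\<in>I. ereal t)"
  have in_I: "t \<in> I" if t: "a < ereal t" "ereal t < b" for t
  proof -
    obtain u where "u \<in> I" "u < t" using t(1) by (auto simp: a_def INF_less_iff)
    moreover obtain w where "w \<in> I" "t < w" using t(2) by (auto simp: b_def less_SUP_iff)
    ultimately show ?thesis using \<open>is_interval I\<close> by (meson less_imp_le mem_is_interval_1_I)
  qed
  have bounds: "a < ereal t \<and> ereal t < b" if t: "t \<in> I" for t
  proof -
    obtain e where e: "e > 0" "ball t e \<subseteq> I" using \<open>open I\<close> t open_contains_ball by blast
    then have "t - e / 2 \<in> I" "t + e / 2 \<in> I" by (auto simp: dist_real_def intro!: subsetD[OF e(2)])
    then have "a \<le> ereal (t - e / 2)" "ereal (t + e / 2) \<le> b"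
      unfolding a_def b_def by (auto intro: INF_lower SUP_upper)
    moreover have "ereal (t - e / 2) < ereal t" "ereal t < ereal (t + e / 2)" using e(1) by auto
    ultimately show ?thesis by (blast intro: le_less_trans less_le_trans)
  qed
  have "a < b" using bounds \<open>I \<noteq> {}\<close> less_trans by blast
  have "\<exists>F. \<forall>t. a < ereal t \<longrightarrow> ereal t < b \<longrightarrow> (F has_vector_derivative f t) (at t)"
    using f \<open>open I\<close> in_I by (intro einterval_antiderivative \<open>a < b\<close>) (simp add: continuous_on_eq_continuous_at)
  then obtain F where "\<And>t. a < ereal t \<Longrightarrow> ereal t < b \<Longrightarrow> (F has_vector_derivative f t) (at t)" by blast
  then show ?thesis
    using bounds by (intro that[of F]) (simp add: has_real_derivative_iff_has_vector_derivative)
qed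

lemma smooth_on_antiderivative:
  fixes F :: "real \<Rightarrow> 'b::real_normed_vector"
  assumes "open I" "smooth_on I f" "\<And>t. t \<in> I \<Longrightarrow> (F has_vector_derivative f t) (at t)"
  shows "smooth_on I F"
proof -
  have "times_differentiable_on (Suc n) I F" for n
  proof (rule times_differentiable_on_SucI[OF assms(1)])
    show "(F has_derivative (\<lambda>v. v *\<^sub>R f t)) (at t)" if "t \<in> I" for t
      using assms(3)[OF that] by (simp add: has_vector_derivative_def)
    show "times_differentiable_on n I (\<lambda>t. v *\<^sub>R f t)" for v
      using assms(2) unfolding smooth_on_def
      by (intro times_differentiable_on_bounded_linear[OF bounded_linear_scaleR_right assms(1)]) blast
  qed
  then show ?thesis unfolding smooth_on_def using times_differentiable_on_SucD by blast
qed

lemma smooth_on_exp: "smooth_on UNIV (exp :: real \<Rightarrow> real)"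
  by (rule smooth_on_autonomous_ode[where T = UNIV and V = "\<lambda>y. y"])
     (auto intro!: smooth_on_linear bounded_linear_ident DERIV_exp
       simp: has_real_derivative_iff_has_vector_derivative[symmetric])

lemma smooth_on_has_real_derivative:
  "smooth_on J \<phi> \<Longrightarrow> s \<in> J \<Longrightarrow> (\<phi> has_real_derivative deriv \<phi> s) (at s)"
  using smooth_on_has_vector_derivative[of J \<phi> s] DERIV_imp_deriv[of \<phi> _ s]
  by (auto simp: has_real_derivative_iff_has_vector_derivative)

section \<open>Change of parameter and the geodesic equation\<close>

lemma covariant_acceleration_eq:
  "covariant_acceleration D nabla \<gamma> t = vector_derivative (velocity \<gamma>) (at t)
     + bilinear_with (christoffel D nabla (\<gamma> t)) (velocity \<gamma> t) (velocity \<gamma> t)"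
  by (simp add: covariant_acceleration_def bilinear_with_def christoffel_def)

lemma velocity_reparametrization:
  assumes "regular_curve I \<gamma>" "smooth_on J \<phi>" "\<phi> s \<in> I" "s \<in> J"
  shows "((\<gamma> \<circ> \<phi>) has_vector_derivative deriv \<phi> s *\<^sub>R velocity \<gamma> (\<phi> s)) (at s)"
  using vector_diff_chain_at[OF smooth_on_has_real_derivative[OF assms(2,4), unfolded has_real_derivative_iff_has_vector_derivative]
      regular_curve_has_velocity[OF assms(1,3)]] .

text \<open>The Christoffel term is quadratic in the velocity and so scales by the same factor
  \<phi>'^2 as the second derivative of \<gamma>. A change of parameter thus adds only a tangential
  term, which the determinant with the velocity ignores.\<close>

lemma covariant_acceleration_reparametrization:
  assumes \<gamma>: "regular_curve I \<gamma>" and \<phi>: "open J" "smooth_on J \<phi>" "\<phi> ` J \<subseteq> I" and s: "s \<in> J"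
    and \<phi>'': "(deriv \<phi> has_real_derivative c) (at s)"
  shows "covariant_acceleration D nabla (\<gamma> \<circ> \<phi>) s =
     c *\<^sub>R velocity \<gamma> (\<phi> s) + (deriv \<phi> s)\<^sup>2 *\<^sub>R covariant_acceleration D nabla \<gamma> (\<phi> s)"
proof -
  have vel: "velocity (\<gamma> \<circ> \<phi>) r = deriv \<phi> r *\<^sub>R velocity \<gamma> (\<phi> r)" if "r \<in> J" for r
    unfolding velocity_def[of "\<gamma> \<circ> \<phi>"]
    by (rule vector_derivative_at[OF velocity_reparametrization[OF \<gamma> \<phi>(2)]]) (use \<phi>(3) that in auto)
  have "\<phi> s \<in> I" using \<phi>(3) s by auto
  then have "(velocity \<gamma> has_vector_derivative vector_derivative (velocity \<gamma>) (at (\<phi> s))) (at (\<phi> s))"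
    by (rule smooth_on_has_vector_derivative[OF regular_curve_smooth_velocity[OF \<gamma>]])
  from vector_diff_chain_at[OF smooth_on_has_real_derivative[OF \<phi>(2) s, unfolded has_real_derivative_iff_has_vector_derivative] this]
  have "((\<lambda>r. velocity \<gamma> (\<phi> r)) has_vector_derivative deriv \<phi> s *\<^sub>R vector_derivative (velocity \<gamma>) (at (\<phi> s))) (at s)"
    by (simp add: o_def)
  from has_vector_derivative_scaleR[OF \<phi>'' this]
  have "(velocity (\<gamma> \<circ> \<phi>) has_vector_derivative
      deriv \<phi> s *\<^sub>R deriv \<phi> s *\<^sub>R vector_derivative (velocity \<gamma>) (at (\<phi> s)) + c *\<^sub>R velocity \<gamma> (\<phi> s)) (at s)"
    by (rule has_vector_derivative_transform_within_open[OF _ \<phi>(1) s]) (simp add: vel)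
  then have "vector_derivative (velocity (\<gamma> \<circ> \<phi>)) (at s) =
      deriv \<phi> s *\<^sub>R deriv \<phi> s *\<^sub>R vector_derivative (velocity \<gamma>) (at (\<phi> s)) + c *\<^sub>R velocity \<gamma> (\<phi> s)"
    by (rule vector_derivative_at)
  then show ?thesis
    by (simp add: covariant_acceleration_eq vel[OF s] bilinear_with_scaleR_left bilinear_with_scaleR_right
        power2_eq_square algebra_simps)
qed

lemma cross2_covariant_acceleration:
  "cross2 (velocity \<gamma> t) (covariant_acceleration D nabla \<gamma> t) =
     cross2 (velocity \<gamma> t) (vector_derivative (velocity \<gamma>) (at t))
       + projective_cubic D nabla (\<gamma> t) (velocity \<gamma> t)"
  by (simp add: covariant_acceleration_eq cross2_add_right projective_cubic_def)

lemma unparametrized_geodesicD: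
  assumes geo: "unparametrized_geodesic D nabla I \<gamma>" and t: "t \<in> I"
  shows "cross2 (velocity \<gamma> t) (covariant_acceleration D nabla \<gamma> t) = 0"
proof -
  obtain J \<phi> where \<gamma>: "regular_curve I \<gamma>" and \<phi>: "reparametrization J I \<phi>"
    and aff: "affine_geodesic D nabla J (\<gamma> \<circ> \<phi>)"
    using geo unfolding unparametrized_geodesic_def by blast
  obtain s where s: "s \<in> J" "\<phi> s = t" using \<phi> t by (auto simp: reparametrization_def)
  have J: "open J" "smooth_on J \<phi>" "\<phi> ` J \<subseteq> I" and nz: "deriv \<phi> s \<noteq> 0"
    using \<phi> s by (auto simp: reparametrization_def open_interval_def)
  have "smooth_on J (deriv \<phi>)"
    by (rule smooth_on_cong[OF J(1) _ smooth_on_vector_derivative[OF J(1,2)]])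
       (use smooth_on_has_real_derivative[OF J(2)] in
         \<open>auto simp: has_real_derivative_iff_has_vector_derivative intro: vector_derivative_at\<close>)
  then obtain c where c: "(deriv \<phi> has_real_derivative c) (at s)"
    using smooth_on_has_real_derivative s(1) by blast
  have "c *\<^sub>R velocity \<gamma> t + (deriv \<phi> s)\<^sup>2 *\<^sub>R covariant_acceleration D nabla \<gamma> t = 0"
    using covariant_acceleration_reparametrization[OF \<gamma> J s(1) c, of D nabla] aff s
    by (simp add: affine_geodesic_def)
  then have "cross2 (velocity \<gamma> t) (c *\<^sub>R velocity \<gamma> t + (deriv \<phi> s)\<^sup>2 *\<^sub>R covariant_acceleration D nabla \<gamma> t) = 0"
    by (simp add: cross2_def)
  then show ?thesis using nz by (simp add: cross2_add_right)
qed

text \<open>If \<open>A = \<lambda> v\<close> for the covariant acceleration \<open>A\<close> and the velocity \<open>v\<close>, then the inverse \<open>\<phi>\<close> of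
  a solution of \<open>\<psi>'' = \<lambda> \<psi>'\<close> turns the curve into an affinely parametrized geodesic.\<close>

lemma unparametrized_geodesicI:
  assumes D: "open D" and conn: "affine_connection D nabla"
    and \<gamma>: "regular_curve I \<gamma>" "\<gamma> ` I \<subseteq> D"
    and cross: "\<And>t. t \<in> I \<Longrightarrow> cross2 (velocity \<gamma> t) (covariant_acceleration D nabla \<gamma> t) = 0"
  shows "unparametrized_geodesic D nabla I \<gamma>"
proof -
  have oi: "open_interval I" and \<gamma>_smooth: "smooth_on I \<gamma>" and vnz: "\<And>t. t \<in> I \<Longrightarrow> velocity \<gamma> t \<noteq> 0"
    using \<gamma>(1) by (auto simp: regular_curve_def)
  then have I: "open I" "is_interval I" "I \<noteq> {}" by (auto simp: open_interval_def)
  note v_smooth = regular_curve_smooth_velocity[OF \<gamma>(1)]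
  have "smooth_on I (\<lambda>t. christoffel D nabla (\<gamma> t) i j)" for i j
    by (rule smooth_on_compose[OF I(1) smooth_on_christoffel[OF D conn] \<gamma>_smooth \<gamma>(2)])
  then have A_smooth: "smooth_on I (covariant_acceleration D nabla \<gamma>)"
    unfolding covariant_acceleration_eq[abs_def]
    by (intro smooth_on_add smooth_on_bilinear_with smooth_on_vector_derivative I v_smooth)
  define l where "l t = (covariant_acceleration D nabla \<gamma> t \<bullet> velocity \<gamma> t) / (velocity \<gamma> t \<bullet> velocity \<gamma> t)" for t
  have l_smooth: "smooth_on I l"
    unfolding l_def[abs_def] by (intro smooth_on_divide smooth_on_inner I A_smooth v_smooth) (simp add: vnz)
  have A: "covariant_acceleration D nabla \<gamma> t = l t *\<^sub>R velocity \<gamma> t" if "t \<in> I" for t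
    unfolding l_def using cross[OF that] vnz[OF that] by (rule cross2_eq_0D)
  obtain F where F: "\<And>t. t \<in> I \<Longrightarrow> (F has_real_derivative l t) (at t)"
    using antiderivative_on_open_interval[OF oi smooth_on_imp_continuous_on[OF l_smooth]] by blast
  have F_smooth: "smooth_on I F"
    by (rule smooth_on_antiderivative[OF I(1) l_smooth])
       (simp add: F has_real_derivative_iff_has_vector_derivative[symmetric])
  \<comment> \<open>Since F' = l, an antiderivative \<psi> of exp F solves \<psi>'' = l \<psi>';
    positivity of exp makes \<psi> strictly increasing, hence invertible.\<close>
  have "continuous_on I (\<lambda>t. exp (F t))"
    by (intro continuous_on_exp smooth_on_imp_continuous_on F_smooth)
  then obtain \<psi> where \<psi>: "\<And>t. t \<in> I \<Longrightarrow> (\<psi> has_real_derivative exp (F t)) (at t)"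
    using antiderivative_on_open_interval[OF oi] by blast
  have \<psi>_cont: "continuous_on I \<psi>"
    using \<psi> by (meson DERIV_isCont continuous_at_imp_continuous_on)
  have \<psi>_less: "\<psi> r < \<psi> t" if "r \<in> I" "t \<in> I" "r < t" for r t
  proof (rule DERIV_pos_imp_increasing[OF that(3)])
    fix x assume "r \<le> x" "x \<le> t"
    then have "x \<in> I" using that I(2) mem_is_interval_1_I by blast
    then show "\<exists>y. (\<psi> has_real_derivative y) (at x) \<and> 0 < y" using \<psi> by (metis exp_gt_zero)
  qed
  then have inj: "inj_on \<psi> I" by (intro linorder_inj_onI) (auto simp: less_imp_neq)
  define J where "J = \<psi> ` I"
  define \<phi> where "\<phi> = the_inv_into I \<psi>"
  have \<phi>\<psi>: "\<phi> (\<psi> t) = t" if "t \<in> I" for t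
    unfolding \<phi>_def using inj that by (rule the_inv_into_f_f)
  have "open J" unfolding J_def by (rule invariance_of_domain[OF \<psi>_cont I(1) inj])
  moreover have "is_interval J" unfolding J_def is_interval_connected_1
    using \<psi>_cont I(2) by (simp add: connected_continuous_image is_interval_connected_1)
  ultimately have oJ: "open_interval J" using I(3) by (auto simp: open_interval_def J_def)
  have \<phi>J: "\<phi> ` J = I" using \<phi>\<psi> by (force simp: J_def)
  have \<phi>I: "\<phi> s \<in> I" if "s \<in> J" for s using \<phi>J that by blast
  have \<phi>_der: "(\<phi> has_real_derivative exp (- F (\<phi> s))) (at s)" if s: "s \<in> J" for s
  proof -
    obtain t where t: "t \<in> I" "s = \<psi> t" using s by (auto simp: J_def)
    have "(\<phi> has_derivative (*) (exp (- F t))) (at (\<psi> t))"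
      by (rule has_derivative_inverse_strong[OF I(1) t(1) \<psi>_cont \<phi>\<psi> \<psi>[OF t(1), unfolded has_field_derivative_def]])
         (auto simp: fun_eq_iff exp_minus)
    then show ?thesis using t by (simp add: \<phi>\<psi> has_field_derivative_def)
  qed
  \<comment> \<open>The inverse \<phi> solves the autonomous equation with this right-hand side, so
    it is smooth.\<close>
  have "smooth_on I (\<lambda>t. exp (- F t))"
    by (rule smooth_on_compose[OF I(1) smooth_on_exp smooth_on_minus[OF I(1) F_smooth]]) simp
  then have \<phi>_smooth: "smooth_on J \<phi>"
    by (rule smooth_on_autonomous_ode[OF \<open>open J\<close>])
       (use \<phi>J \<phi>_der in \<open>auto simp: has_real_derivative_iff_has_vector_derivative[symmetric]\<close>)
  have d\<phi>: "deriv \<phi> s = exp (- F (\<phi> s))" if "s \<in> J" for s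
    using \<phi>_der[OF that] by (rule DERIV_imp_deriv)
  have rep: "reparametrization J I \<phi>"
    using oJ \<phi>_smooth \<phi>J by (simp add: reparametrization_def d\<phi>)
  have vel: "velocity (\<gamma> \<circ> \<phi>) s = deriv \<phi> s *\<^sub>R velocity \<gamma> (\<phi> s)" if "s \<in> J" for s
    unfolding velocity_def[of "\<gamma> \<circ> \<phi>"]
    by (rule vector_derivative_at[OF velocity_reparametrization[OF \<gamma>(1) \<phi>_smooth \<phi>I[OF that] that]])
  have "smooth_on J (\<gamma> \<circ> \<phi>)"
    unfolding o_def using \<phi>J by (intro smooth_on_compose[OF \<open>open J\<close> \<gamma>_smooth \<phi>_smooth]) simp
  then have "regular_curve J (\<gamma> \<circ> \<phi>)"
    using oJ vnz \<phi>I by (simp add: regular_curve_def vel d\<phi>)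
  moreover have "covariant_acceleration D nabla (\<gamma> \<circ> \<phi>) s = 0" if s: "s \<in> J" for s
  proof -
    let ?E = "exp (- F (\<phi> s))"
    \<comment> \<open>That is, \<phi>'' = - l \<phi>'^2 with \<open>l\<close> taken at \<phi> s:
      exactly what cancels the term \<phi>'^2 A = \<phi>'^2 l v of the transformed covariant
      acceleration.\<close>
    have "((\<lambda>s. exp (- F (\<phi> s))) has_real_derivative - (l (\<phi> s) * ?E\<^sup>2)) (at s)"
      using DERIV_chain2[OF F[OF \<phi>I[OF s]] \<phi>_der[OF s]]
      by (auto intro!: derivative_eq_intros simp: power2_eq_square)
    then have "(deriv \<phi> has_real_derivative - (l (\<phi> s) * ?E\<^sup>2)) (at s)"
      by (rule has_field_derivative_transform_within_open[OF _ \<open>open J\<close> s]) (simp add: d\<phi>)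
    from covariant_acceleration_reparametrization[OF \<gamma>(1) \<open>open J\<close> \<phi>_smooth _ s this, of D nabla] \<phi>J
    show ?thesis by (simp add: A \<phi>I s d\<phi> mult.commute)
  qed
  moreover have "(\<gamma> \<circ> \<phi>) ` J \<subseteq> D" using \<gamma>(2) \<phi>J by (auto simp: image_comp[symmetric])
  ultimately have "affine_geodesic D nabla J (\<gamma> \<circ> \<phi>)" by (simp add: affine_geodesic_def)
  then show ?thesis using \<gamma>(1) rep by (auto simp: unparametrized_geodesic_def)
qed

section \<open>The cubic of a planar 4-web\<close>

lemma foliation_leaf_through:
  assumes "foliation D \<F>" "p \<in> D"
  obtains L where "L \<in> \<F>" "p \<in> L"
  using assms unfolding foliation_def partition_on_def by blast

lemma tangent_field_parallel:
  assumes fol: "foliation D \<F>" "p \<in> D"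
    and web: "web_function \<F> U f" "p \<in> U" "web_function \<F> U' f'" "p \<in> U'"
  obtains c where "tangent_field f' p = c *\<^sub>R tangent_field f p"
proof -
  obtain L where L: "L \<in> \<F>" "p \<in> L" using fol by (rule foliation_leaf_through)
  obtain I \<gamma> t where \<gamma>: "regular_curve I \<gamma>" "\<gamma> ` I \<subseteq> L" "t \<in> I" "\<gamma> t = p"
    using leaf_curve_through[OF web(1) L web(2)] by blast
  obtain s where s: "s \<noteq> 0" "velocity \<gamma> t = s *\<^sub>R tangent_field f p"
    using leaf_velocity[OF web(1) L(1) \<gamma>(1-3)] \<gamma>(4) web(2) by metis
  obtain s' where s': "s' \<noteq> 0" "velocity \<gamma> t = s' *\<^sub>R tangent_field f' p"
    using leaf_velocity[OF web(3) L(1) \<gamma>(1-3)] \<gamma>(4) web(4) by metis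
  have "tangent_field f' p = inverse s' *\<^sub>R (s' *\<^sub>R tangent_field f' p)" using s'(1) by simp
  also have "\<dots> = (inverse s' * s) *\<^sub>R tangent_field f p" using s(2) s'(2) by simp
  finally show ?thesis by (rule that)
qed

lemma tangent_field_transversal:
  assumes fol: "foliation D \<F>" "foliation D \<G>" "transversal_foliations D \<F> \<G>" and p: "p \<in> D"
    and f: "web_function \<F> U f" "p \<in> U" and g: "web_function \<G> V g" "p \<in> V"
  shows "cross2 (tangent_field f p) (tangent_field g p) \<noteq> 0"
proof
  assume 0: "cross2 (tangent_field f p) (tangent_field g p) = 0"
  obtain U' f' V' g' where f': "web_function \<F> U' f'" "p \<in> U'" and g': "web_function \<G> V' g'" "p \<in> V'"
    and wedge: "wedge (differential f' p) (differential g' p) \<noteq> (\<lambda>v w. 0)"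
    using fol(3) p unfolding transversal_foliations_def by blast
  obtain a where a: "tangent_field f' p = a *\<^sub>R tangent_field f p"
    using tangent_field_parallel[OF fol(1) p f f'] by blast
  obtain b where b: "tangent_field g' p = b *\<^sub>R tangent_field g p"
    using tangent_field_parallel[OF fol(2) p g g'] by blast
  obtain c where c: "tangent_field g p = c *\<^sub>R tangent_field f p"
    using cross2_eq_0D[OF 0 tangent_field_nonzero[OF f]] by blast
  have "smooth_on U' f'" "smooth_on V' g'" using f' g' by (auto simp: web_function_def)
  then have "wedge (differential f' p) (differential g' p) = (\<lambda>v w. 0)"
    using f'(2) g'(2)
    by (simp add: fun_eq_iff wedge_def differential_eq_cross2 a b c)
  with wedge show False by simp
qed

definition leaf_cubic :: "(nat \<Rightarrow> plane set set) \<Rightarrow> plane \<Rightarrow> (plane \<Rightarrow> real) \<Rightarrow> bool" where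
  "leaf_cubic W p q \<longleftrightarrow> binary_cubic q \<and>
     (\<forall>i<4. \<forall>L\<in>W i. \<forall>I \<gamma>. \<forall>t\<in>I. regular_curve I \<gamma> \<longrightarrow> \<gamma> ` I \<subseteq> L \<longrightarrow> \<gamma> t = p \<longrightarrow>
        cross2 (velocity \<gamma> t) (vector_derivative (velocity \<gamma>) (at t)) + q (velocity \<gamma> t) = 0)"

lemma planar_web_functions:
  assumes web: "planar_web d D W" and p: "p \<in> D"
  obtains U f where "\<And>i. i < d \<Longrightarrow> p \<in> U i" "\<And>i. i < d \<Longrightarrow> U i \<subseteq> D" "\<And>i. i < d \<Longrightarrow> web_function (W i) (U i) (f i)"
    "\<And>i j q. i < d \<Longrightarrow> j < d \<Longrightarrow> i \<noteq> j \<Longrightarrow> q \<in> U i \<Longrightarrow> q \<in> U j \<Longrightarrow>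
       cross2 (tangent_field (f i) q) (tangent_field (f j) q) \<noteq> 0"
proof -
  have "\<forall>i. \<exists>U. \<exists>f. i < d \<longrightarrow> p \<in> U \<and> U \<subseteq> D \<and> web_function (W i) U f"
  proof
    fix i
    show "\<exists>U. \<exists>f. i < d \<longrightarrow> p \<in> U \<and> U \<subseteq> D \<and> web_function (W i) U f"
    proof (cases "i < d")
      case True
      then have "foliation D (W i)" using web by (simp add: planar_web_def)
      then show ?thesis using p unfolding foliation_def by meson
    qed simp
  qed
  from choice[OF this] obtain U where
    "\<forall>i. \<exists>f. i < d \<longrightarrow> p \<in> U i \<and> U i \<subseteq> D \<and> web_function (W i) (U i) f" ..
  from choice[OF this] obtain f where
    Uf: "i < d \<Longrightarrow> p \<in> U i \<and> U i \<subseteq> D \<and> web_function (W i) (U i) (f i)" for i by blast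
  moreover have "cross2 (tangent_field (f i) q) (tangent_field (f j) q) \<noteq> 0"
    if "i < d" "j < d" "i \<noteq> j" "q \<in> U i" "q \<in> U j" for i j q
    using that web Uf[OF that(1)] Uf[OF that(2)] unfolding planar_web_def
    by (intro tangent_field_transversal[of D "W i" "W j" _ "U i" _ "U j"]) auto
  ultimately show ?thesis using that[of U f] by blast
qed

lemma leaf_cubic_unique:
  assumes web: "planar_web 4 D W" and p: "p \<in> D" and q: "leaf_cubic W p q" "leaf_cubic W p r"
  shows "q = r"
proof -
  obtain U f where Uf: "\<And>i. i < 4 \<Longrightarrow> p \<in> U i" "\<And>i. i < 4 \<Longrightarrow> web_function (W i) (U i) (f i)"
    and trans: "\<And>i j. i < 4 \<Longrightarrow> j < 4 \<Longrightarrow> i \<noteq> j \<Longrightarrow> cross2 (tangent_field (f i) p) (tangent_field (f j) p) \<noteq> 0"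
    by (rule planar_web_functions[OF web p]) metis
  have "\<exists>s. s \<noteq> 0 \<and> q (s *\<^sub>R tangent_field (f i) p) = r (s *\<^sub>R tangent_field (f i) p)" if i: "i < 4" for i
  proof -
    obtain L where L: "L \<in> W i" "p \<in> L"
      using web i p foliation_leaf_through[of D "W i" p] by (auto simp: planar_web_def)
    obtain I \<gamma> t where \<gamma>: "regular_curve I \<gamma>" "\<gamma> ` I \<subseteq> L" "t \<in> I" "\<gamma> t = p"
      using leaf_curve_through[OF Uf(2)[OF i] L Uf(1)[OF i]] by blast
    obtain s where s: "s \<noteq> 0" "velocity \<gamma> t = s *\<^sub>R tangent_field (f i) p"
      using leaf_velocity[OF Uf(2)[OF i] L(1) \<gamma>(1-3)] \<gamma>(4) Uf(1)[OF i] by metis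
    have "cross2 (velocity \<gamma> t) (vector_derivative (velocity \<gamma>) (at t)) + h (velocity \<gamma> t) = 0"
      if "leaf_cubic W p h" for h
      using that i L(1) \<gamma> unfolding leaf_cubic_def by blast
    from this[OF q(1)] this[OF q(2)] have "q (velocity \<gamma> t) = r (velocity \<gamma> t)" by linarith
    then show ?thesis using s by auto
  qed
  then obtain s where s: "\<And>i. i < 4 \<Longrightarrow> s i \<noteq> 0"
    "\<And>i. i < 4 \<Longrightarrow> q (s i *\<^sub>R tangent_field (f i) p) = r (s i *\<^sub>R tangent_field (f i) p)" by metis
  show ?thesis
    by (rule binary_cubic_eqI[where V = "\<lambda>i. s i *\<^sub>R tangent_field (f i) p"])
       (use q s trans in \<open>auto simp: leaf_cubic_def\<close>)
qed

lemma leaf_cubic_locally: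
  assumes web: "planar_web 4 D W" and p: "p \<in> D"
  obtains U q where "open U" "p \<in> U" "U \<subseteq> D" "\<And>v. smooth_on U (\<lambda>x. q x v)"
    "\<And>x. x \<in> U \<Longrightarrow> leaf_cubic W x (q x)"
proof -
  obtain U f where Uf: "\<And>i. i < 4 \<Longrightarrow> p \<in> U i" "\<And>i. i < 4 \<Longrightarrow> U i \<subseteq> D" "\<And>i. i < 4 \<Longrightarrow> web_function (W i) (U i) (f i)"
    and trans: "\<And>i j q. i < 4 \<Longrightarrow> j < 4 \<Longrightarrow> i \<noteq> j \<Longrightarrow> q \<in> U i \<Longrightarrow> q \<in> U j \<Longrightarrow>
       cross2 (tangent_field (f i) q) (tangent_field (f j) q) \<noteq> 0"
    using planar_web_functions[OF web p] by blast
  define U0 where "U0 = (\<Inter>i<4. U i)"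
  have UU: "x \<in> U i" if "x \<in> U0" "i < 4" for x i using that by (auto simp: U0_def)
  have "open U0" unfolding U0_def using Uf(3) by (intro open_INT) (auto simp: web_function_def)
  have smooth: "smooth_on U0 (f i)" if "i < 4" for i
    by (rule smooth_on_subset[of "U i"]) (use Uf(3)[OF that] UU that in \<open>auto simp: web_function_def\<close>)
  define V where "V i x = tangent_field (f i) x" for i x
  define h where "h i x = hess (f i) x (V i x)" for i x
  define q where "q x = cubic_interpolant (\<lambda>i. V i x) (\<lambda>i. h i x)" for x
  have V_smooth: "smooth_on U0 (V i)" if "i < 4" for i
    unfolding V_def[abs_def] by (rule smooth_on_tangent_field[OF \<open>open U0\<close> smooth[OF that]])
  have h_smooth: "smooth_on U0 (h i)" if "i < 4" for i
    unfolding h_def[abs_def] by (rule smooth_on_hess[OF \<open>open U0\<close> smooth[OF that] V_smooth[OF that]])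
  have cross: "cross2 (V i x) (V j x) \<noteq> 0" if "i < 4" "j < 4" "i \<noteq> j" "x \<in> U0" for i j x
    unfolding V_def using trans that UU by blast
  show ?thesis
  proof (rule that)
    show "open U0" "p \<in> U0" "U0 \<subseteq> D" using \<open>open U0\<close> Uf(1) UU[of _ 0] Uf(2)[of 0] by (auto simp: U0_def)
    show "smooth_on U0 (\<lambda>x. q x v)" for v
      unfolding q_def by (rule smooth_on_cubic_interpolant[OF \<open>open U0\<close> V_smooth h_smooth cross])
  next
    fix x assume x: "x \<in> U0"
    show "leaf_cubic W x (q x)"
      unfolding leaf_cubic_def
    proof (intro conjI allI impI ballI)
      show cubic: "binary_cubic (q x)" unfolding q_def by (rule binary_cubic_interpolant)
      fix i :: nat and L I \<gamma> t
      assume i: "i < 4" and L: "L \<in> W i" and \<gamma>: "t \<in> I" "regular_curve I \<gamma>" "\<gamma> ` I \<subseteq> L" "\<gamma> t = x"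
      obtain s where "velocity \<gamma> t = s *\<^sub>R V i x"
        "cross2 (velocity \<gamma> t) (vector_derivative (velocity \<gamma>) (at t)) = - (s ^ 3 * h i x)"
        using leaf_velocity[OF Uf(3)[OF i] L \<gamma>(2,3,1)] \<gamma>(4) UU[OF x i] unfolding V_def h_def by metis
      moreover have "q x (V i x) = h i x"
        unfolding q_def by (rule cubic_interpolant_node[OF i]) (use cross x in auto)
      ultimately show "cross2 (velocity \<gamma> t) (vector_derivative (velocity \<gamma>) (at t)) + q x (velocity \<gamma> t) = 0"
        by (simp add: binary_cubic_scaleR[OF cubic])
    qed
  qed
qed

lemma leaf_cubic_field:
  assumes D: "open D" and web: "planar_web 4 D W"
  obtains Q where "\<And>v. smooth_on D (\<lambda>p. Q p v)" "\<And>p. p \<in> D \<Longrightarrow> leaf_cubic W p (Q p)"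
proof (rule that)
  let ?Q = "\<lambda>p. THE q. leaf_cubic W p q"
  have Q: "?Q p = q" if "p \<in> D" "leaf_cubic W p q" for p q
    using that leaf_cubic_unique[OF web] by (blast intro: the_equality)
  show "leaf_cubic W p (?Q p)" if p: "p \<in> D" for p
    using leaf_cubic_locally[OF web p] Q[OF p] by metis
  show "smooth_on D (\<lambda>p. ?Q p v)" for v
  proof (rule smooth_on_locally)
    fix p assume "p \<in> D"
    then obtain U q where U: "open U" "p \<in> U" "U \<subseteq> D" and q: "smooth_on U (\<lambda>x. q x v)"
      "\<And>x. x \<in> U \<Longrightarrow> leaf_cubic W x (q x)"
      using leaf_cubic_locally[OF web] by metis
    have "q x v = ?Q x v" if "x \<in> U" for x
      using Q[of x "q x"] q(2)[OF that] that U(3) by (simp add: subsetD)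
    then have "smooth_on U (\<lambda>p. ?Q p v)"
      by (rule smooth_on_cong[OF U(1) _ q(1)])
    with U show "\<exists>U. open U \<and> p \<in> U \<and> smooth_on U (\<lambda>p. ?Q p v)" by blast
  qed
qed

lemma smooth_on_cubic_coeffs:
  assumes "open D" "\<And>v. smooth_on D (\<lambda>p. Q p v)"
  shows "smooth_on D (\<lambda>p. cubic_coeffs (Q p) i j)"
proof -
  consider "i \<noteq> j" | "i = j" "i = 1" | "i = j" "i \<noteq> 1" by blast
  then show ?thesis
    by cases (simp_all add: cubic_coeffs_def smooth_on_const, (intro smooth_on_add smooth_on_scaleR
      smooth_on_diff smooth_on_minus smooth_on_divide assms smooth_on_const; simp)+)
qed

lemma planar_web_leaf_subset: "planar_web d D W \<Longrightarrow> i < d \<Longrightarrow> L \<in> W i \<Longrightarrow> L \<subseteq> D"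
  unfolding planar_web_def foliation_def partition_on_def by blast

lemma leaf_is_geodesicI:
  assumes D: "open D" and web: "planar_web 4 D W" and nabla: "affine_connection D nabla" "nabla \<in> P"
    and cubic: "\<And>p. p \<in> D \<Longrightarrow> leaf_cubic W p (projective_cubic D nabla p)"
    and L: "i < 4" "L \<in> W i"
  shows "leaf_is_geodesic D P L"
  unfolding leaf_is_geodesic_def projective_geodesic_def
proof (intro allI impI bexI[of _ nabla] nabla)
  fix I \<gamma> assume \<gamma>: "regular_curve I \<gamma> \<and> \<gamma> ` I \<subseteq> L"
  have "\<gamma> ` I \<subseteq> D" using \<gamma> planar_web_leaf_subset[OF web L] by blast
  moreover have "cross2 (velocity \<gamma> t) (covariant_acceleration D nabla \<gamma> t) = 0" if "t \<in> I" for t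
    using cubic[of "\<gamma> t"] that \<gamma> L \<open>\<gamma> ` I \<subseteq> D\<close>
    unfolding cross2_covariant_acceleration leaf_cubic_def by blast
  ultimately show "unparametrized_geodesic D nabla I \<gamma>"
    using \<gamma> by (intro unparametrized_geodesicI[OF D nabla(1)]) auto
qed

lemma leaf_cubic_projective_cubic:
  assumes D: "open D" and P: "P \<in> projective_structures D" "nabla \<in> P"
    and geo: "\<forall>i<4. \<forall>L\<in>W i. leaf_is_geodesic D P L" and p: "p \<in> D"
  shows "leaf_cubic W p (projective_cubic D nabla p)"
  unfolding leaf_cubic_def
proof (intro conjI allI impI ballI binary_cubic_projective_cubic)
  fix i :: nat and L I \<gamma> t
  assume "i < 4" "L \<in> W i" and \<gamma>: "t \<in> I" "regular_curve I \<gamma>" "\<gamma> ` I \<subseteq> L" "\<gamma> t = p"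
  then obtain nabla' where nabla': "nabla' \<in> P" "unparametrized_geodesic D nabla' I \<gamma>"
    using geo unfolding leaf_is_geodesic_def projective_geodesic_def by blast
  have "(nabla, nabla') \<in> projective_relation D"
    using in_quotient_imp_in_rel[OF equiv_projective_relation[OF D]] P nabla'(1)
    by (simp add: projective_structures_eq)
  then have "projective_cubic D nabla p = projective_cubic D nabla' p"
    using projectively_equivalent_iff_cubic[OF D] p unfolding projective_relation_def by blast
  then show "cross2 (velocity \<gamma> t) (vector_derivative (velocity \<gamma>) (at t)) + projective_cubic D nabla p (velocity \<gamma> t) = 0"
    using unparametrized_geodesicD[OF nabla'(2) \<gamma>(1)] \<gamma>(4) by (simp add: cross2_covariant_acceleration)
qed

theorem theorem8:
  fixes D :: "plane set" and W :: "nat \<Rightarrow> plane set set"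
  assumes "open D" and "connected D" and "D \<noteq> {}"
    and "planar_web 4 D W"
  shows "\<exists>!P. P \<in> projective_structures D \<and>
              (\<forall>i<4. \<forall>L\<in>W i. leaf_is_geodesic D P L)"
proof -
  note D = assms(1) and web = assms(4)
  note equiv = equiv_projective_relation[OF D]
  obtain Q where Q: "\<And>v. smooth_on D (\<lambda>p. Q p v)" "\<And>p. p \<in> D \<Longrightarrow> leaf_cubic W p (Q p)"
    using leaf_cubic_field[OF D web] by blast
  define nabla where "nabla = connection_of D (\<lambda>p. cubic_coeffs (Q p))"
  have conn: "affine_connection D nabla"
    unfolding nabla_def by (intro affine_connection_connection_of smooth_on_cubic_coeffs D Q)
  moreover have "torsion_free D nabla"
    unfolding nabla_def by (rule torsion_free_connection_of) (simp add: cubic_coeffs_def)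
  ultimately have nabla: "nabla \<in> torsion_free_connections D" by (simp add: torsion_free_connections_def)
  have cubic: "projective_cubic D nabla p = Q p" if "p \<in> D" for p
    using Q(2)[OF that] that
    by (auto simp: fun_eq_iff projective_cubic_def nabla_def christoffel_connection_of[OF D]
        cross2_cubic_coeffs leaf_cubic_def)
  let ?P = "projective_relation D `` {nabla}"
  show ?thesis
  proof (rule ex1I[of _ ?P])
    have "nabla \<in> ?P" using equiv nabla by (rule equiv_class_self)
    then show "?P \<in> projective_structures D \<and> (\<forall>i<4. \<forall>L\<in>W i. leaf_is_geodesic D ?P L)"
      using leaf_is_geodesicI[OF D web conn, of ?P] cubic Q(2) nabla
      by (simp add: projective_structures_eq quotientI)
  next
    fix P assume P: "P \<in> projective_structures D \<and> (\<forall>i<4. \<forall>L\<in>W i. leaf_is_geodesic D P L)"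
    then have "P \<noteq> {}" "P \<subseteq> torsion_free_connections D"
      using in_quotient_imp_non_empty[OF equiv] in_quotient_imp_subset[OF equiv]
      by (auto simp: projective_structures_eq)
    then obtain nabla' where nabla': "nabla' \<in> P" "nabla' \<in> torsion_free_connections D" by blast
    have "projective_cubic D nabla' p = projective_cubic D nabla p" if "p \<in> D" for p
      using leaf_cubic_unique[OF web that leaf_cubic_projective_cubic[OF D _ nabla'(1)]] P that Q(2) cubic
      by simp
    then have "(nabla', nabla) \<in> projective_relation D"
      using projectively_equivalent_iff_cubic[OF D nabla'(2) nabla] nabla nabla'(2)
      by (simp add: projective_relation_def)
    then show "P = ?P"
      using quotient_eqI[OF equiv _ quotientI[OF nabla] nabla'(1) equiv_class_self[OF equiv nabla]] P
      by (simp add: projective_structures_eq)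
  qed
qed

end
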